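(* Let $T\in(0,\infty)$, $d\in\mathbb{N}$, $u_0\in\mathbb{R}^d$, $p\in[2,\infty)$, and let $f\colon[0,T]\times\mathbb{R}^d\to\mathbb{R}^d$ be measurable. Suppose there are measurable mappings $L,K\colon[0,T]\to[0,\infty)$ with $\|L\|_{L^p([0,T];\mathbb{R})}<\infty$ and $\|K\|_{L^p([0,T];\mathbb{R})}<\infty$ such that for almost all $t\in[0,T]$ and all $x_1,x_2\in\mathbb{R}^d$ $$|f(t,x_1)-f(t,x_2)|\le L(t)|x_1-x_2|,$$ and $|f(t,0)|\le K(t)$ for almost all $t\in[0,T]$. Let $u$ denote the exact solution to $\dot u(t)=f(t,u(t))$, $t\in[0,T]$, $u(0)=u_0$. For given $h\in(0,1)$ let $(U^j)_{j\in\{0,1,\ldots,N_h\}}$ be the randomized Euler approximation determined by $U^0=u_0$ and $$U^j=U^{j-1}+hf(t_{j-1}+\tau_jh,U^{j-1}),\quad j\in\{1,\ldots,N_h\}.$$ Then there exists $C\in(0,\infty)$, independent of $h\in(0,1)$, such that $$\Big\|\max_{n\in\{0,1,\ldots,N_h\}}|u(t_n)-U^n|\Big\|_{L^p(\Omega;\mathbb{R})}\le Ch^{\frac12}.$$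
   Context: $|\cdot|$ is the Euclidean norm on $\mathbb{R}^d$. $(\tau_j)_{j\in\mathbb{N}}$ is an independent family of random variables, each uniformly distributed on $(0,1)$, on a probability space $(\Omega,\mathcal{F},\mathbb{P})$. $\|X\|_{L^p(\Omega;\mathbb{R})}=(\mathbb{E}[|X|^p])^{1/p}$. For $h\in(0,1)$, $t_j=jh$ and $N_h\in\{0,1,2,\ldots\}$ is the integer determined by $N_hh\le T<(N_h+1)h$. A solution of the initial value problem is an absolutely continuous $u\colon[0,T]\to\mathbb{R}^d$ with $u(t)=u_0+\int_0^tf(s,u(s))\,\mathrm{d}s$ for all $t\in[0,T]$ (in particular $t\mapsto f(t,u(t))$ is integrable). Under the stated hypotheses on $f$ there is a unique solution. *)

theory Defs
  imports "HOL-Probability.Probability"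
begin

text \<open>The \<open>L\<^sup>p\<close> norm for real \<open>p > 0\<close>, with value \<open>\<infinity>\<close> if the \<open>p\<close>-th moment is infinite
  (there is no power with real exponent on the type \<^typ>\<open>ennreal\<close>).\<close>

definition Lp_norm :: "'a measure \<Rightarrow> real \<Rightarrow> ('a \<Rightarrow> real) \<Rightarrow> ennreal" where
  "Lp_norm M p X =
    (let I = (\<integral>\<^sup>+ \<omega>. ennreal (\<bar>X \<omega>\<bar> powr p) \<partial>M)
     in if I = \<infinity> then \<infinity> else ennreal (enn2real I powr (1 / p)))"

text \<open>Absolute continuity of a function on a real interval; not to be confused with the library's
  \<^const>\<open>absolutely_continuous\<close>, which is about measures.\<close>

definition abs_continuous_on :: "real set \<Rightarrow> (real \<Rightarrow> 'b::real_normed_vector) \<Rightarrow> bool" where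
  "abs_continuous_on S g \<longleftrightarrow>
    (\<forall>\<epsilon>>0. \<exists>\<delta>>0. \<forall>(n::nat) a b.
      (\<forall>i<n. a i \<le> b i \<and> {a i..b i} \<subseteq> S) \<longrightarrow>
      disjoint_family_on (\<lambda>i. {a i<..<b i}) {..<n} \<longrightarrow>
      (\<Sum>i<n. b i - a i) < \<delta> \<longrightarrow>
      (\<Sum>i<n. norm (g (b i) - g (a i))) < \<epsilon>)"

text \<open>Functions on \<open>[0,T]\<close> are represented by total functions whose values outside \<open>[0,T]\<close> are
  never constrained.\<close>

definition is_ode_solution ::
    "real \<Rightarrow> (real \<Rightarrow> real ^ 'd \<Rightarrow> real ^ 'd) \<Rightarrow> real ^ 'd \<Rightarrow> (real \<Rightarrow> real ^ 'd) \<Rightarrow> bool" where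
  "is_ode_solution T f u\<^sub>0 u \<longleftrightarrow>
    abs_continuous_on {0..T} u \<and>
    set_integrable lborel {0..T} (\<lambda>s. f s (u s)) \<and>
    (\<forall>t\<in>{0..T}. u t = u\<^sub>0 + (LINT s:{0..t}|lborel. f s (u s)))"

definition num_steps :: "real \<Rightarrow> real \<Rightarrow> nat" where
  "num_steps T h = (THE N. real N * h \<le> T \<and> T < (real N + 1) * h)"

lemma num_steps_eq_iff:
  assumes "0 < h" "0 \<le> T"
  shows "num_steps T h = N \<longleftrightarrow> real N * h \<le> T \<and> T < (real N + 1) * h"
proof -
  have *: "real k * h \<le> T \<and> T < (real k + 1) * h \<longleftrightarrow> k = nat \<lfloor>T / h\<rfloor>" for k
  proof -
    have "real k * h \<le> T \<and> T < (real k + 1) * h \<longleftrightarrow>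
        of_int (int k) \<le> T / h \<and> T / h < of_int (int k) + 1"
      using assms by (simp add: field_simps)
    also have "\<dots> \<longleftrightarrow> \<lfloor>T / h\<rfloor> = int k"
      by (simp add: floor_eq_iff)
    also have "\<dots> \<longleftrightarrow> k = nat \<lfloor>T / h\<rfloor>"
      using assms by auto
    finally show ?thesis .
  qed
  show ?thesis
    unfolding num_steps_def * by auto
qed

text \<open>One path of the scheme: the argument \<open>\<tau>\<close> is a realisation of the random sequence, and
  only its entries with index at least 1 are used.\<close>

primrec rand_euler ::
    "(real \<Rightarrow> real ^ 'd \<Rightarrow> real ^ 'd) \<Rightarrow> real ^ 'd \<Rightarrow> real \<Rightarrow> (nat \<Rightarrow> real) \<Rightarrow> nat \<Rightarrow> real ^ 'd" where
  "rand_euler f u\<^sub>0 h \<tau> 0 = u\<^sub>0"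
| "rand_euler f u\<^sub>0 h \<tau> (Suc j) =
    rand_euler f u\<^sub>0 h \<tau> j + h *\<^sub>R f (real j * h + \<tau> (Suc j) * h) (rand_euler f u\<^sub>0 h \<tau> j)"

end

theory Submission
  imports Defs
begin

text \<open>Put \<open>\<theta>\<^sub>i = t\<^sub>i + \<tau>\<^sub>i\<^sub>+\<^sub>1 h\<close> and \<open>g s = f s (u s)\<close>. The error satisfies
  \<open>u t\<^sub>n - U\<^sup>n = S\<^sub>n + (\<Sum>i<n. h (g \<theta>\<^sub>i - f \<theta>\<^sub>i U\<^sup>i))\<close>, where \<open>S\<^sub>n\<close> is the error of the randomized
  Riemann sum for the integral of \<open>g\<close>. This is a sum of independent centred variables, so
  a maximal moment inequality gives order \<open>1/2\<close>. The remaining terms are at most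
  \<open>h L(\<theta>\<^sub>i) (b\<^sub>i + |u t\<^sub>i - U\<^sup>i|)\<close>, where \<open>b\<^sub>i\<close> is the integral of \<open>|g|\<close> over the \<open>i\<close>-th step, which is
  of order \<open>h powr (1 - 1/p)\<close>. Since \<open>\<theta>\<^sub>i\<close> is independent of \<open>U\<^sup>i\<close>, the \<open>p\<close>-th moments satisfy a
  discrete Gronwall inequality whose weights are the integrals of \<open>L powr p\<close> over the steps.\<close>

section \<open>Power inequalities\<close>

text \<open>No regularity in time is available: \<open>g\<close> is only p-integrable, so a Riemann
  sum at fixed nodes need not have a rate. A uniform node makes every step unbiased. The centred
  errors have p-th moments of order h^(p-1) times the local integral of |g|^p, and the factor
  n^(p/2-1) of the maximal inequality turns h^(p-1) into h^(p/2). For the local terms, Jensen gives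
  b_i^p \<le> h^(p-1) Q, and h^(p-1) \<le> h^(p/2) because p \<ge> 2 and h < 1. Since
  \<open>L\<close> may be unbounded, a pathwise Gronwall argument would need exponential moments of
  the sum of h L(\<theta>_i). Therefore p-th powers and expectations are taken before Gronwall, on
  the running maximum of the error, and independence replaces L(\<theta>_i)^p by its mean. No moment
  of the error is known to be finite at that stage, so the recursion is run in [0, infinity]. The
  analytic input is the supporting line of a convex power, \<open>powr_diff_le\<close>: it yields
  the power mean inequality, Jensen, the expansion of |x+y|^p and Doob's inequality.\<close>

lemma powr_diff_le:
  fixes s t q :: real
  assumes "0 \<le> s" "0 \<le> t" "1 \<le> q"
  shows "s powr q - t powr q \<le> q * s powr (q - 1) * (s - t)"
proof (cases "s = 0 \<or> t = 0")
  case True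
  have "s powr q = s powr (q - 1) * s" using assms powr_add[of s "q - 1" 1] by simp
  moreover have "s powr (q - 1) * s \<le> q * (s powr (q - 1) * s)"
    using assms mult_right_mono[of 1 q "s powr (q-1) * s"] by simp
  ultimately show ?thesis using True by auto
next
  case False
  then have pos: "0 < s" "0 < t" using assms by auto
  \<comment> \<open>Young's inequality with weights (q-1)/q and 1/q; multiplied by q it is the
    supporting line of x^q at \<open>s\<close>, evaluated at \<open>t\<close>.\<close>
  have "(s powr q) powr ((q - 1) / q) * (t powr q) powr (1 / q) \<le> (q - 1) / q * s powr q + 1 / q * t powr q"
    using assms pos by (intro Youngs_inequality_0) (auto simp: field_simps)
  then have "s powr (q - 1) * t \<le> (q - 1) / q * s powr q + 1 / q * t powr q"
    using assms pos by (simp add: powr_powr)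
  then have *: "q * (s powr (q - 1) * t) \<le> (q - 1) * s powr q + t powr q"
    using assms by (simp add: field_simps)
  have "s powr q = s powr (q - 1) * s" using pos powr_add[of s "q - 1" 1] by simp
  then show ?thesis using * by (simp add: algebra_simps)
qed

lemma powr_add_le:
  fixes a b p :: real
  assumes "0 \<le> a" "0 \<le> b" "0 \<le> p"
  shows "(a + b) powr p \<le> 2 powr p * (a powr p + b powr p)"
proof -
  have "(a + b) powr p \<le> (2 * max a b) powr p"
    using assms by (intro powr_mono2) auto
  also have "\<dots> = 2 powr p * max a b powr p"
    using assms by (simp add: powr_mult)
  also have "\<dots> \<le> 2 powr p * (a powr p + b powr p)"
    by (intro mult_left_mono) (auto simp: max_def)
  finally show ?thesis .
qed

text \<open>Power mean inequality: the supporting lines at the arithmetic mean are added up, and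
  their linear terms cancel.\<close>

lemma powr_sum_le:
  fixes x :: "'i \<Rightarrow> real"
  assumes "finite I" "\<And>i. i \<in> I \<Longrightarrow> 0 \<le> x i" "1 \<le> q"
  shows "(\<Sum>i\<in>I. x i) powr q \<le> real (card I) powr (q - 1) * (\<Sum>i\<in>I. x i powr q)"
proof (cases "I = {}")
  case False
  define n where "n = real (card I)"
  define s where "s = (\<Sum>i\<in>I. x i) / n"
  have n: "0 < n" using False assms(1) by (auto simp: n_def card_gt_0_iff)
  have s: "0 \<le> s" using assms(2) n by (auto simp: s_def intro!: divide_nonneg_pos sum_nonneg)
  have "(\<Sum>i\<in>I. s powr q - x i powr q) \<le> (\<Sum>i\<in>I. q * s powr (q - 1) * (s - x i))"
    using assms s by (intro sum_mono powr_diff_le) auto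
  also have "\<dots> = q * s powr (q - 1) * (n * s - (\<Sum>i\<in>I. x i))"
    by (simp add: sum_distrib_left[symmetric] sum_subtractf n_def)
  also have "\<dots> = 0" using n by (simp add: s_def)
  finally have "n * s powr q \<le> (\<Sum>i\<in>I. x i powr q)"
    by (simp add: sum_subtractf n_def)
  then have "n powr (q - 1) * (n * s powr q) \<le> n powr (q - 1) * (\<Sum>i\<in>I. x i powr q)"
    by (intro mult_left_mono) auto
  moreover have "n powr (q - 1) * (n * s powr q) = (n * s) powr q"
    using n s powr_add[of n "q - 1" 1] by (simp add: powr_mult)
  ultimately show ?thesis using n by (simp add: s_def n_def)
qed simp

text \<open>Young's inequality with weights (p-2)/p and 2/p, the powers of \<open>h\<close> being
  chosen so that they cancel in the product. The small factor \<open>h\<close> in front of m^p can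
  be iterated over 1/h steps at bounded cost; the price is h^(1-p/2) on the other term.\<close>

lemma young_powr:
  fixes m y h p :: real
  assumes "0 \<le> m" "0 \<le> y" "0 < h" "2 \<le> p"
  shows "y\<^sup>2 * m powr (p - 2) \<le> h * m powr p + h powr (1 - p / 2) * y powr p"
proof (cases "m = 0 \<or> y = 0")
  case True
  then show ?thesis using assms by auto
next
  case False
  then have pos: "0 < m" "0 < y" using assms by auto
  have "(h * m powr p) powr ((p - 2) / p) * (h powr (1 - p / 2) * y powr p) powr (2 / p)
      \<le> (p - 2) / p * (h * m powr p) + 2 / p * (h powr (1 - p / 2) * y powr p)"
    using assms pos by (intro Youngs_inequality_0) (auto simp: field_simps)
  also have "\<dots> \<le> 1 * (h * m powr p) + 1 * (h powr (1 - p / 2) * y powr p)"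
    using assms by (intro add_mono mult_right_mono) auto
  also have "(h * m powr p) powr ((p - 2) / p) * (h powr (1 - p / 2) * y powr p) powr (2 / p)
     = (h powr ((p - 2) / p) * h powr ((1 - p / 2) * (2 / p))) * (m powr (p - 2) * y powr 2)"
    using assms pos by (simp add: powr_mult powr_powr)
  also have "h powr ((p - 2) / p) * h powr ((1 - p / 2) * (2 / p)) = 1"
  proof -
    have "(p - 2) / p + (1 - p / 2) * (2 / p) = 0" using assms by (simp add: field_simps)
    then show ?thesis using assms by (simp add: powr_add[symmetric])
  qed
  finally show ?thesis using pos by (simp add: mult.commute)
qed

text \<open>For \<alpha> < 1 the power is not Lipschitz near 0; the factor \<open>t\<close> repairs
  this. Replacing one \<open>t\<close> by \<open>s\<close> bounds the left side by a difference of
  (\<alpha>+1)-th powers, to which the supporting line at the larger point applies.\<close>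

lemma powr_diff_mult_le:
  fixes s t \<alpha> :: real
  assumes "0 \<le> s" "0 \<le> t" "0 \<le> \<alpha>"
  shows "\<bar>s powr \<alpha> - t powr \<alpha>\<bar> * t \<le> (\<alpha> + 1) * \<bar>s - t\<bar> * max s t powr \<alpha>"
proof -
  have id: "x powr \<alpha> * x = x powr (\<alpha> + 1)" if "0 \<le> x" for x :: real
    using that powr_add[of x \<alpha> 1] by simp
  show ?thesis
  proof (cases "s \<le> t")
    case True
    have "\<bar>s powr \<alpha> - t powr \<alpha>\<bar> * t = t powr (\<alpha> + 1) - s powr \<alpha> * t"
      using True assms powr_mono2[of \<alpha> s t]
      unfolding id[OF assms(2), symmetric] by (simp add: algebra_simps)
    also have "\<dots> \<le> t powr (\<alpha> + 1) - s powr (\<alpha> + 1)"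
      using True by (simp add: id[symmetric] assms mult_left_mono)
    also have "\<dots> \<le> (\<alpha> + 1) * t powr \<alpha> * (t - s)"
      using powr_diff_le[of t s "\<alpha> + 1"] assms by simp
    finally show ?thesis using True by (simp add: max_def mult_ac)
  next
    case False
    have "\<bar>s powr \<alpha> - t powr \<alpha>\<bar> * t = s powr \<alpha> * t - t powr (\<alpha> + 1)"
      using False assms powr_mono2[of \<alpha> t s]
      unfolding id[OF assms(2), symmetric] by (simp add: algebra_simps)
    also have "\<dots> \<le> s powr (\<alpha> + 1) - t powr (\<alpha> + 1)"
      using False by (simp add: id[symmetric] assms mult_left_mono)
    also have "\<dots> \<le> (\<alpha> + 1) * s powr \<alpha> * (s - t)"
      using powr_diff_le[of s t "\<alpha> + 1"] assms by simp
    finally show ?thesis using False by (simp add: max_def mult_ac)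
  qed
qed

text \<open>A second-order Taylor bound for the p-th power of the norm, obtained without
  derivatives. The linear term is kept exactly because it has mean zero when \<open>y\<close> is
  centred and independent of \<open>x\<close>; only the remainder is estimated.\<close>

lemma norm_add_powr_le:
  fixes x y :: "'b::real_inner"
  assumes "2 \<le> p"
  shows "norm (x + y) powr p \<le> norm x powr p + p * norm x powr (p - 2) * (x \<bullet> y)
    + p\<^sup>2 * ((norm y)\<^sup>2 * (norm x + norm y) powr (p - 2))"
proof -
  define z where "z = x + y"
  \<comment> \<open>\<open>p\<close> times \<open>v\<close> is the gradient of the p-th power of the
    norm; the remainder is the increment of this field tested against \<open>y\<close>.\<close>
  define v where "v w = norm w powr (p - 2) *\<^sub>R w" for w :: 'b
  define m where "m = norm x + norm y"
  have m: "norm z \<le> m" "norm x \<le> m" "0 \<le> m" by (auto simp: m_def z_def norm_triangle_ineq)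
  have id1: "norm z powr (p - 1) = norm z powr (p - 2) * norm z"
    using powr_add[of "norm z" "p - 2" 1] by simp
  have id2: "norm z powr p = norm z powr (p - 2) * (norm z)\<^sup>2"
    using powr_add[of "norm z" "p - 2" 2] by (cases "z = 0") auto
  have "norm z powr p - norm x powr p \<le> p * norm z powr (p - 1) * (norm z - norm x)"
    using assms by (intro powr_diff_le) auto
  also have "\<dots> = p * norm z powr (p - 2) * ((norm z)\<^sup>2 - norm z * norm x)"
    by (simp add: id1 algebra_simps power2_eq_square)
  also have "\<dots> \<le> p * norm z powr (p - 2) * (z \<bullet> y)"
    using assms norm_cauchy_schwarz[of z x]
    by (intro mult_left_mono) (auto simp: z_def power2_norm_eq_inner algebra_simps inner_commute)
  also have "\<dots> = p * (v x \<bullet> y) + p * ((v z - v x) \<bullet> y)"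
    by (simp add: v_def inner_diff_left algebra_simps)
  also have "(v z - v x) \<bullet> y \<le> norm (v z - v x) * norm y"
    by (rule norm_cauchy_schwarz)
  \<comment> \<open>The split isolates a difference of powers times \<open>norm x\<close>, the shape
    treated by \<open>powr_diff_mult_le\<close>, where p - 2 may lie below 1. The two parts
    contribute 1 and p - 1, which together give the second factor of p^2.\<close>
  also have "v z - v x = norm z powr (p - 2) *\<^sub>R y + (norm z powr (p - 2) - norm x powr (p - 2)) *\<^sub>R x"
    by (simp add: v_def z_def algebra_simps)
  also have "norm \<dots> \<le> norm z powr (p - 2) * norm y + \<bar>norm z powr (p - 2) - norm x powr (p - 2)\<bar> * norm x"
    by (rule norm_triangle_le) auto
  also have "\<bar>norm z powr (p - 2) - norm x powr (p - 2)\<bar> * norm x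
      \<le> (p - 2 + 1) * \<bar>norm z - norm x\<bar> * max (norm z) (norm x) powr (p - 2)"
    using assms by (intro powr_diff_mult_le) auto
  also have "\<dots> \<le> (p - 1) * norm y * m powr (p - 2)"
    using assms m norm_triangle_ineq3[of z x] by (intro mult_mono powr_mono2) (auto simp: z_def le_max_iff_disj)
  also have "norm z powr (p - 2) * norm y \<le> m powr (p - 2) * norm y"
    using assms m by (intro mult_right_mono powr_mono2) auto
  finally have "norm z powr p - norm x powr p
      \<le> p * (v x \<bullet> y) + p * ((m powr (p - 2) * norm y + (p - 1) * norm y * m powr (p - 2)) * norm y)"
    using assms by (simp add: mult_left_mono mult_right_mono)
  also have "\<dots> = p * norm x powr (p - 2) * (x \<bullet> y) + p\<^sup>2 * ((norm y)\<^sup>2 * m powr (p - 2))"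
    by (simp add: v_def algebra_simps power2_eq_square)
  finally show ?thesis by (simp add: z_def m_def)
qed

text \<open>A form made for iteration: with h = 1/n, the factor 1 + C h applied n times stays below
  exp C. In \<open>C\<close>, the 2^p stems from splitting (|x| + |y|)^p and the 1 from Young's
  inequality.\<close>

lemma norm_add_powr_le_scaled:
  fixes x y :: "'b::real_inner"
  assumes "2 \<le> p" "0 < h" "h \<le> 1"
  defines "C \<equiv> p\<^sup>2 * (2 powr p + 1)"
  shows "norm (x + y) powr p \<le> (1 + C * h) * norm x powr p + p * norm x powr (p - 2) * (x \<bullet> y)
    + C * h powr (1 - p / 2) * norm y powr p"
proof -
  define A where "A = norm x powr p"
  define B where "B = norm y powr p"
  define H where "H = h powr (1 - p / 2)"
  have nn: "0 \<le> A" "0 \<le> B" by (auto simp: A_def B_def)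
  have H: "1 \<le> H"
    using assms powr_mono2'[of "1 - p / 2" h 1] by (simp add: H_def)
  have "(norm y)\<^sup>2 * (norm x + norm y) powr (p - 2) \<le> h * (norm x + norm y) powr p + H * B"
    unfolding H_def B_def using assms by (intro young_powr) auto
  also have "h * (norm x + norm y) powr p \<le> h * (2 powr p * (A + B))"
    unfolding A_def B_def using assms by (intro mult_left_mono powr_add_le) auto
  also have "\<dots> = 2 powr p * h * A + 2 powr p * (h * B)" by (simp add: algebra_simps)
  also have "h * B \<le> H * B" using assms H nn by (intro mult_right_mono) auto
  also have "2 powr p * h * A \<le> (2 powr p + 1) * h * A" using nn assms by (intro mult_right_mono) auto
  finally have "(norm y)\<^sup>2 * (norm x + norm y) powr (p - 2) \<le> (2 powr p + 1) * (h * A + H * B)"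
    by (simp add: algebra_simps)
  then have "p\<^sup>2 * ((norm y)\<^sup>2 * (norm x + norm y) powr (p - 2)) \<le> C * (h * A + H * B)"
    unfolding C_def mult.assoc by (intro mult_left_mono) auto
  with norm_add_powr_le[OF assms(1), of x y] show ?thesis
    by (simp add: A_def B_def H_def algebra_simps)
qed

section \<open>Moments of maxima of independent sums\<close>

text \<open>Serves twice: for partial sums against the next increment, and for the Euler error
  against the next sampling point. Restricting to \<open>{1..k}\<close> makes the past an element of
  a finite product space.\<close>

lemma (in prob_space) indep_var_past_next:
  assumes "indep_vars (\<lambda>_. N) X {1..}"
    and "F \<in> measurable (\<Pi>\<^sub>M j\<in>{1..k}. N) N1" and "G \<in> measurable N N2"
  shows "indep_var N1 (\<lambda>\<omega>. F (restrict (\<lambda>j. X j \<omega>) {1..k})) N2 (\<lambda>\<omega>. G (X (Suc k) \<omega>))"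
proof -
  have ind: "indep_var (\<Pi>\<^sub>M j\<in>{1..k}. N) (\<lambda>\<omega>. restrict (\<lambda>j. X j \<omega>) {1..k})
      (\<Pi>\<^sub>M j\<in>{Suc k}. N) (\<lambda>\<omega>. restrict (\<lambda>j. X j \<omega>) {Suc k})"
    using assms(1) by (rule indep_var_restrict) auto
  have "(\<lambda>x. G (x (Suc k))) \<in> measurable (\<Pi>\<^sub>M j\<in>{Suc k}. N) N2"
    by (rule measurable_compose[OF _ assms(3)], rule measurable_component_singleton) simp
  from indep_var_compose[OF ind assms(2) this] show ?thesis
    by (simp add: comp_def)
qed

text \<open>The joint law is a product, so Tonelli applies. Values in \<open>ennreal\<close> allow
  the factorisation for error moments whose finiteness is still open.\<close>

lemma (in prob_space) indep_var_nn_integral: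
  fixes X Y :: "'a \<Rightarrow> ennreal"
  assumes ind: "indep_var borel X borel Y"
  shows "(\<integral>\<^sup>+\<omega>. X \<omega> * Y \<omega> \<partial>M) = (\<integral>\<^sup>+\<omega>. X \<omega> \<partial>M) * (\<integral>\<^sup>+\<omega>. Y \<omega> \<partial>M)"
proof -
  note eq = ind[unfolded indep_var_distribution_eq]
  have [measurable]: "X \<in> borel_measurable M" "Y \<in> borel_measurable M" using eq by auto
  interpret Y: prob_space "distr M borel Y" by (rule prob_space_distr) simp
  have "(\<integral>\<^sup>+\<omega>. X \<omega> * Y \<omega> \<partial>M) = (\<integral>\<^sup>+z. fst z * snd z \<partial>distr M (borel \<Otimes>\<^sub>M borel) (\<lambda>\<omega>. (X \<omega>, Y \<omega>)))"
    by (subst nn_integral_distr) auto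
  also have "\<dots> = (\<integral>\<^sup>+z. fst z * snd z \<partial>(distr M borel X \<Otimes>\<^sub>M distr M borel Y))"
    using eq by simp
  also have "\<dots> = (\<integral>\<^sup>+x. (\<integral>\<^sup>+y. x * y \<partial>distr M borel Y) \<partial>distr M borel X)"
    by (subst Y.nn_integral_fst[symmetric]) auto
  also have "\<dots> = (\<integral>\<^sup>+\<omega>. X \<omega> \<partial>M) * (\<integral>\<^sup>+\<omega>. Y \<omega> \<partial>M)"
    by (simp add: nn_integral_cmult nn_integral_multc nn_integral_distr)
  finally show ?thesis .
qed

text \<open>Expanding the inner product in the basis reduces the claim to products of independent
  real variables.\<close>

lemma (in prob_space) indep_var_inner_mean_zero:
  fixes X Y :: "'a \<Rightarrow> 'b::euclidean_space"
  assumes ind: "indep_var borel X borel Y" and X: "integrable M X" and Y: "integrable M Y"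
    and mean: "expectation Y = 0"
  shows "integrable M (\<lambda>\<omega>. X \<omega> \<bullet> Y \<omega>)" "expectation (\<lambda>\<omega>. X \<omega> \<bullet> Y \<omega>) = 0"
proof -
  have ind_b: "indep_var borel (\<lambda>\<omega>. X \<omega> \<bullet> b) borel (\<lambda>\<omega>. Y \<omega> \<bullet> b)" for b :: 'b
    using indep_var_compose[OF ind, of "\<lambda>x. x \<bullet> b" borel "\<lambda>x. x \<bullet> b" borel] by (simp add: comp_def)
  have int_b: "integrable M (\<lambda>\<omega>. (X \<omega> \<bullet> b) * (Y \<omega> \<bullet> b))" for b
    using X Y by (intro indep_var_integrable ind_b) auto
  have "expectation (\<lambda>\<omega>. (X \<omega> \<bullet> b) * (Y \<omega> \<bullet> b)) = 0" for b
    using X Y mean indep_var_lebesgue_integral[OF ind_b[of b]] by simp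
  then show "integrable M (\<lambda>\<omega>. X \<omega> \<bullet> Y \<omega>)" "expectation (\<lambda>\<omega>. X \<omega> \<bullet> Y \<omega>) = 0"
    using int_b by (auto simp: euclidean_inner[of "X _" "Y _"])
qed

text \<open>If \<open>s\<close> exceeds \<open>m\<close>, the potential at the new maximum equals
  -s^p, and comparing this with the old value is exactly the supporting line inequality at
  \<open>m\<close>. Otherwise nothing changes.\<close>

lemma doob_potential_step:
  fixes m s p :: real
  assumes "0 \<le> m" "0 \<le> s" "1 \<le> p"
  defines "m' \<equiv> max m s"
  shows "(p - 1) * m' powr p - p * m' powr (p - 1) * s \<le> (p - 1) * m powr p - p * m powr (p - 1) * s"
proof (cases "s \<le> m")
  case False
  have id: "x powr p = x powr (p - 1) * x" if "0 \<le> x" for x :: real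
    using that powr_add[of x "p - 1" 1] by simp
  have "m powr p - s powr p \<le> p * m powr (p - 1) * (m - s)"
    using assms by (intro powr_diff_le) auto
  then show ?thesis
    using False assms unfolding m'_def by (simp add: max_def id algebra_simps)
qed (simp add: m'_def max_def)

text \<open>Once the potential has nonpositive mean, this gives Doob's inequality with constant 2^p.
  It is the supporting line at \<open>m\<close> evaluated at 2s; since p \<ge> 2, the resulting p
  m^p is at most 2 (p-1) m^p.\<close>

lemma doob_potential_ge:
  fixes m s p :: real
  assumes "0 \<le> m" "0 \<le> s" "2 \<le> p"
  shows "m powr p \<le> 2 powr p * s powr p + 2 * ((p - 1) * m powr p - p * m powr (p - 1) * s)"
proof -
  have id: "m powr p = m powr (p - 1) * m" 
    using assms powr_add[of m "p - 1" 1] by simp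
  have "m powr p - (2 * s) powr p \<le> p * m powr (p - 1) * (m - 2 * s)"
    using assms by (intro powr_diff_le) auto
  moreover have "m powr p \<le> (p - 1) * m powr p" using assms by (simp add: mult_right_mono[of 1 "p - 1" "m powr p", simplified])
  ultimately show ?thesis
    using assms by (simp add: id powr_mult algebra_simps)
qed

lemma Max_norm_Suc:
  fixes S :: "nat \<Rightarrow> 'b::real_normed_vector"
  shows "Max ((\<lambda>k. norm (S k)) ` {0..Suc n}) = max (Max ((\<lambda>k. norm (S k)) ` {0..n})) (norm (S (Suc n)))"
  by (subst atLeast0_atMost_Suc, subst image_insert, subst Max_insert) (auto simp: max.commute)

lemma Max_norm_nonneg:
  fixes S :: "nat \<Rightarrow> 'b::real_normed_vector"
  shows "0 \<le> Max ((\<lambda>k. norm (S k)) ` {0..n})"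
  by (subst Max_ge_iff) auto

lemma Max_norm_powr_le:
  fixes S :: "nat \<Rightarrow> 'b::real_normed_vector"
  shows "Max ((\<lambda>k. norm (S k)) ` {0..n}) powr p \<le> (\<Sum>k=0..n. norm (S k) powr p)"
proof -
  have "Max ((\<lambda>k. norm (S k)) ` {0..n}) \<in> (\<lambda>k. norm (S k)) ` {0..n}" by (rule Max_in) auto
  then obtain k where k: "Max ((\<lambda>k. norm (S k)) ` {0..n}) = norm (S k)" "k \<in> {0..n}"
    by (rule imageE)
  show ?thesis unfolding k(1) using k(2) by (intro member_le_sum) auto
qed

lemma powr_le_one_plus:
  fixes x a b :: real
  assumes "0 \<le> x" "0 \<le> a" "a \<le> b"
  shows "x powr a \<le> 1 + x powr b"
proof (cases "x \<le> 1")
  case True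
  then have "x powr a \<le> 1 powr a" using assms by (intro powr_mono2) auto
  then show ?thesis using powr_ge_zero[of x b] unfolding powr_one_eq_one by linarith
next
  case False
  then have "x powr a \<le> x powr b" using assms by (intro powr_mono) auto
  then show ?thesis by simp
qed

text \<open>Jensen's inequality: integrating the supporting line at the mean removes the linear
  term.\<close>

lemma (in prob_space) expectation_powr_le:
  fixes X :: "'a \<Rightarrow> real"
  assumes "integrable M X" "integrable M (\<lambda>\<omega>. X \<omega> powr q)" "\<And>\<omega>. 0 \<le> X \<omega>" "1 \<le> q"
  shows "expectation X powr q \<le> expectation (\<lambda>\<omega>. X \<omega> powr q)"
proof -
  define s where "s = expectation X"
  have "0 \<le> s" unfolding s_def using assms by (intro Bochner_Integration.integral_nonneg) auto
  then have "expectation (\<lambda>\<omega>. s powr q - X \<omega> powr q) \<le> expectation (\<lambda>\<omega>. q * s powr (q - 1) * (s - X \<omega>))"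
    using assms by (intro integral_mono powr_diff_le) auto
  also have "\<dots> = 0" using assms by (simp add: s_def prob_space)
  finally show ?thesis using assms by (simp add: prob_space s_def)
qed

text \<open>The first part of the argument bounds the moments of the partial sums by a discrete Gronwall
  argument; the second part is Doob's maximal inequality, proved by showing that
  \<open>(p - 1) m\<^sup>p - p m\<^sup>p\<^sup>-\<^sup>1 s\<close>, evaluated at the running maximum \<open>m\<close> and the current norm \<open>s\<close>,
  is a supermartingale.\<close>

lemma (in prob_space) expectation_max_indep_sum_powr_le:
  fixes D :: "nat \<Rightarrow> 'a \<Rightarrow> 'b::euclidean_space" and p :: real
  assumes p: "2 \<le> p" and ind: "indep_vars (\<lambda>_. borel) D {1..}"
    and int: "\<And>j. 1 \<le> j \<Longrightarrow> integrable M (\<lambda>\<omega>. norm (D j \<omega>) powr p)"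
    and mean: "\<And>j. 1 \<le> j \<Longrightarrow> expectation (D j) = 0"
  defines "m \<equiv> (\<lambda>n \<omega>. Max ((\<lambda>k. norm (\<Sum>j=1..k. D j \<omega>)) ` {0..n}))"
    and "C \<equiv> p\<^sup>2 * (2 powr p + 1)"
  shows "integrable M (\<lambda>\<omega>. m n \<omega> powr p)"
    and "expectation (\<lambda>\<omega>. m n \<omega> powr p)
      \<le> 2 powr p * C * exp C * real n powr (p / 2 - 1) * (\<Sum>j=1..n. expectation (\<lambda>\<omega>. norm (D j \<omega>) powr p))"
proof -
  define S where "S k \<omega> = (\<Sum>j=1..k. D j \<omega>)" for k \<omega>
  define \<delta> where "\<delta> j = expectation (\<lambda>\<omega>. norm (D j \<omega>) powr p)" for j
  have C: "0 \<le> C" by (simp add: C_def)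
  have m_def': "m k \<omega> = Max ((\<lambda>k. norm (S k \<omega>)) ` {0..k})" for k \<omega> by (simp add: m_def S_def)
  have m_nonneg: "0 \<le> m k \<omega>" for k \<omega> unfolding m_def' by (rule Max_norm_nonneg)
  have m_Suc: "m (Suc k) \<omega> = max (m k \<omega>) (norm (S (Suc k) \<omega>))" for k \<omega>
    unfolding m_def' by (rule Max_norm_Suc)
  have S_Suc: "S (Suc k) \<omega> = S k \<omega> + D (Suc k) \<omega>" for k \<omega> by (simp add: S_def)
  have D_meas [measurable]: "D j \<in> borel_measurable M" if "1 \<le> j" for j
    using ind that by (auto simp: indep_vars_def)
  have S_meas [measurable]: "S k \<in> borel_measurable M" for k
    unfolding S_def[abs_def] by (intro borel_measurable_sum D_meas) auto
  have m_meas [measurable]: "m k \<in> borel_measurable M" for k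
    unfolding m_def'[abs_def] by measurable
  \<comment> \<open>Only finiteness is wanted here, so the wasteful factor k^(p-1) does no harm; the
    sharp growth comes from \<open>moment\<close>.\<close>
  have S_int: "integrable M (\<lambda>\<omega>. norm (S k \<omega>) powr p)" for k
  proof (rule Bochner_Integration.integrable_bound)
    show "integrable M (\<lambda>\<omega>. real (card {1..k}) powr (p - 1) * (\<Sum>j=1..k. norm (D j \<omega>) powr p))"
      using int by (intro integrable_mult_right Bochner_Integration.integrable_sum) auto
    have "norm (S k \<omega>) powr p \<le> real (card {1..k}) powr (p - 1) * (\<Sum>j=1..k. norm (D j \<omega>) powr p)" for \<omega>
    proof -
      have "norm (S k \<omega>) powr p \<le> (\<Sum>j=1..k. norm (D j \<omega>)) powr p"
        unfolding S_def using p by (intro powr_mono2 norm_sum) auto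
      also have "\<dots> \<le> real (card {1..k}) powr (p - 1) * (\<Sum>j=1..k. norm (D j \<omega>) powr p)"
        using p by (intro powr_sum_le) auto
      finally show ?thesis .
    qed
    then show "AE \<omega> in M. norm (norm (S k \<omega>) powr p) \<le> norm (real (card {1..k}) powr (p - 1) * (\<Sum>j=1..k. norm (D j \<omega>) powr p))"
      by (intro AE_I2) (auto intro: order_trans[OF _ abs_ge_self])
  qed measurable
  have m_int: "integrable M (\<lambda>\<omega>. m k \<omega> powr p)" for k
  proof (rule Bochner_Integration.integrable_bound)
    show "integrable M (\<lambda>\<omega>. (\<Sum>j=0..k. norm (S j \<omega>) powr p))"
      using S_int by (intro Bochner_Integration.integrable_sum) auto
    show "AE \<omega> in M. norm (m k \<omega> powr p) \<le> norm (\<Sum>j=0..k. norm (S j \<omega>) powr p)"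
      using Max_norm_powr_le[of "\<lambda>j. S j _" k p] unfolding m_def' by (intro AE_I2) (auto intro: order_trans[OF _ abs_ge_self])
  qed measurable
  show "integrable M (\<lambda>\<omega>. m n \<omega> powr p)" by (rule m_int)
  have D_int: "integrable M (D j)" if "1 \<le> j" for j
  proof (rule Bochner_Integration.integrable_bound)
    show "integrable M (\<lambda>\<omega>. 1 + norm (D j \<omega>) powr p)" using int[OF that] by simp
    show "AE \<omega> in M. norm (D j \<omega>) \<le> norm (1 + norm (D j \<omega>) powr p)"
      using powr_le_one_plus[of "norm (D j _)" 1 p] p by (intro AE_I2) auto
  qed (use that in measurable)
  \<comment> \<open>Used for two multipliers: |S|^(p-2), which produces the linear term of the norm
    expansion, and m^(p-1)/|S|, which produces the martingale increment in Doob's argument. The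
    growth condition on \<open>G\<close> dominates the integrand by m^(p-1), hence by 1 +
    m^p.\<close>
  have zero: "integrable M (\<lambda>\<omega>. (G (m k \<omega>) (norm (S k \<omega>)) *\<^sub>R S k \<omega>) \<bullet> D (Suc k) \<omega>)"
      "expectation (\<lambda>\<omega>. (G (m k \<omega>) (norm (S k \<omega>)) *\<^sub>R S k \<omega>) \<bullet> D (Suc k) \<omega>) = 0"
    if [measurable]: "(\<lambda>(x, y). G x y) \<in> borel_measurable (borel \<Otimes>\<^sub>M borel)"
      and G: "\<And>a b. 0 \<le> b \<Longrightarrow> b \<le> a \<Longrightarrow> \<bar>G a b\<bar> * b \<le> a powr (p - 1)"
    for G :: "real \<Rightarrow> real \<Rightarrow> real" and k
  proof -
    let ?V = "\<lambda>\<omega>. G (m k \<omega>) (norm (S k \<omega>)) *\<^sub>R S k \<omega>"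
    define F where "F d = G (Max ((\<lambda>i. norm (\<Sum>j=1..i. d j)) ` {0..k})) (norm (\<Sum>j=1..k. d j)) *\<^sub>R (\<Sum>j=1..k. d j)"
      for d :: "nat \<Rightarrow> 'b"
    have sums: "(\<lambda>d :: nat \<Rightarrow> 'b. \<Sum>j=1..i. d j) \<in> borel_measurable (\<Pi>\<^sub>M j\<in>{1..k}. borel)" if "i \<le> k" for i
      using that by (intro borel_measurable_sum measurable_component_singleton) auto
    then have [measurable]: "(\<lambda>d :: nat \<Rightarrow> 'b. \<Sum>j=1..k. d j) \<in> borel_measurable (\<Pi>\<^sub>M j\<in>{1..k}. borel)" by simp
    have [measurable]: "(\<lambda>d :: nat \<Rightarrow> 'b. Max ((\<lambda>i. norm (\<Sum>j=1..i. d j)) ` {0..k})) \<in> borel_measurable (\<Pi>\<^sub>M j\<in>{1..k}. borel)"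
      using sums by (intro borel_measurable_Max borel_measurable_norm) auto
    have F_meas: "F \<in> borel_measurable (\<Pi>\<^sub>M j\<in>{1..k}. borel)"
      unfolding F_def by measurable
    have sum_restrict: "(\<Sum>j=1..i. restrict (\<lambda>j. D j \<omega>) {1..k} j) = S i \<omega>" if "i \<le> k" for i \<omega>
      unfolding S_def using that by (intro sum.cong) auto
    have F_eq: "F (restrict (\<lambda>j. D j \<omega>) {1..k}) = ?V \<omega>" for \<omega>
    proof -
      have "(\<lambda>i. norm (\<Sum>j=1..i. restrict (\<lambda>j. D j \<omega>) {1..k} j)) ` {0..k} = (\<lambda>i. norm (S i \<omega>)) ` {0..k}"
        by (intro image_cong refl arg_cong[where f = norm] sum_restrict) simp
      then show ?thesis
        unfolding F_def m_def' using sum_restrict[of k \<omega>] by simp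
    qed
    have "indep_var borel ?V borel (D (Suc k))"
      using indep_var_past_next[OF ind F_meas, of "\<lambda>x. x" borel] unfolding F_eq by simp
    moreover have "integrable M ?V"
    proof (rule Bochner_Integration.integrable_bound)
      show "integrable M (\<lambda>\<omega>. 1 + m k \<omega> powr p)" using m_int[of k] by simp
      have "norm (?V \<omega>) \<le> 1 + m k \<omega> powr p" for \<omega>
      proof -
        have "norm (S k \<omega>) \<le> m k \<omega>" unfolding m_def' by (intro Max_ge) auto
        then have "norm (?V \<omega>) \<le> m k \<omega> powr (p - 1)" using G by simp
        also have "\<dots> \<le> 1 + m k \<omega> powr p" using p m_nonneg by (intro powr_le_one_plus) auto
        finally show ?thesis .
      qed
      then show "AE \<omega> in M. norm (?V \<omega>) \<le> norm (1 + m k \<omega> powr p)"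
        by (intro AE_I2) (auto intro: order_trans[OF _ abs_ge_self])
    qed measurable
    ultimately show "integrable M (\<lambda>\<omega>. ?V \<omega> \<bullet> D (Suc k) \<omega>)" "expectation (\<lambda>\<omega>. ?V \<omega> \<bullet> D (Suc k) \<omega>) = 0"
      by (rule indep_var_inner_mean_zero; use D_int mean in auto)+
  qed
  \<comment> \<open>\<open>h\<close> is a free parameter at this point; it becomes 1/n only at the
    end.\<close>
  have moment_step: "expectation (\<lambda>\<omega>. norm (S (Suc k) \<omega>) powr p)
      \<le> (1 + C * h) * expectation (\<lambda>\<omega>. norm (S k \<omega>) powr p) + C * h powr (1 - p / 2) * \<delta> (Suc k)"
    if h: "0 < h" "h \<le> 1" for h k
  proof -
    let ?G = "\<lambda>a b. b powr (p - 2) :: real"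
    have G: "\<bar>?G a b\<bar> * b \<le> a powr (p - 1)" if "0 \<le> b" "b \<le> a" for a b :: real
    proof -
      have "\<bar>?G a b\<bar> * b = b powr (p - 1)" using that powr_add[of b "p - 2" 1] by simp
      also have "\<dots> \<le> a powr (p - 1)" using that p by (intro powr_mono2) auto
      finally show ?thesis .
    qed
    have z: "integrable M (\<lambda>\<omega>. norm (S k \<omega>) powr (p - 2) * (S k \<omega> \<bullet> D (Suc k) \<omega>))"
       "expectation (\<lambda>\<omega>. norm (S k \<omega>) powr (p - 2) * (S k \<omega> \<bullet> D (Suc k) \<omega>)) = 0"
      using zero[of ?G k] G by auto
    have "expectation (\<lambda>\<omega>. norm (S (Suc k) \<omega>) powr p) \<le> expectation (\<lambda>\<omega>.
       (1 + C * h) * norm (S k \<omega>) powr p + p * (norm (S k \<omega>) powr (p - 2) * (S k \<omega> \<bullet> D (Suc k) \<omega>))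
    + C * h powr (1 - p / 2) * norm (D (Suc k) \<omega>) powr p)"
    proof (intro integral_mono Bochner_Integration.integrable_add integrable_mult_right)
      fix \<omega>
      show "norm (S (Suc k) \<omega>) powr p \<le> (1 + C * h) * norm (S k \<omega>) powr p
          + p * (norm (S k \<omega>) powr (p - 2) * (S k \<omega> \<bullet> D (Suc k) \<omega>))
          + C * h powr (1 - p / 2) * norm (D (Suc k) \<omega>) powr p"
        using norm_add_powr_le_scaled[OF p h, of "S k \<omega>" "D (Suc k) \<omega>"]
        unfolding S_Suc C_def by (simp only: mult.assoc)
    qed (use S_int int z in auto)
    also have "\<dots> = (1 + C * h) * expectation (\<lambda>\<omega>. norm (S k \<omega>) powr p) + C * h powr (1 - p / 2) * \<delta> (Suc k)"
      using S_int int z by (simp add: \<delta>_def)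
    finally show ?thesis .
  qed
  have moment: "expectation (\<lambda>\<omega>. norm (S k \<omega>) powr p) \<le> (1 + C * h) ^ k * (C * h powr (1 - p / 2) * (\<Sum>j=1..k. \<delta> j))"
    if h: "0 < h" "h \<le> 1" for h k
  proof (induction k)
    case 0
    show ?case using p by (simp add: S_def)
  next
    case (Suc k)
    have \<delta>: "0 \<le> \<delta> j" for j unfolding \<delta>_def by (intro Bochner_Integration.integral_nonneg) auto
    have "expectation (\<lambda>\<omega>. norm (S (Suc k) \<omega>) powr p)
        \<le> (1 + C * h) * ((1 + C * h) ^ k * (C * h powr (1 - p / 2) * (\<Sum>j=1..k. \<delta> j)))
          + 1 * (C * h powr (1 - p / 2) * \<delta> (Suc k))"
      using moment_step[OF h, of k] Suc mult_left_mono[OF Suc, of "1 + C * h"] C h by simp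
    also have "\<dots> \<le> (1 + C * h) * ((1 + C * h) ^ k * (C * h powr (1 - p / 2) * (\<Sum>j=1..k. \<delta> j)))
          + (1 + C * h) ^ Suc k * (C * h powr (1 - p / 2) * \<delta> (Suc k))"
      using C h \<delta> by (intro add_left_mono mult_right_mono one_le_power) auto
    also have "\<dots> = (1 + C * h) ^ Suc k * (C * h powr (1 - p / 2) * (\<Sum>j=1..Suc k. \<delta> j))"
      by (simp add: algebra_simps)
    finally show ?case .
  qed
  let ?F = "\<lambda>k \<omega>. (p - 1) * m k \<omega> powr p - p * m k \<omega> powr (p - 1) * norm (S k \<omega>)"
  have mS_int: "integrable M (\<lambda>\<omega>. m k \<omega> powr (p - 1) * norm (S k \<omega>))" for k
  proof (rule Bochner_Integration.integrable_bound[OF m_int[of k]])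
    have "m k \<omega> powr (p - 1) * norm (S k \<omega>) \<le> m k \<omega> powr p" for \<omega>
    proof -
      have "norm (S k \<omega>) \<le> m k \<omega>" unfolding m_def' by (intro Max_ge) auto
      then have "m k \<omega> powr (p - 1) * norm (S k \<omega>) \<le> m k \<omega> powr (p - 1) * m k \<omega>"
        by (intro mult_left_mono) auto
      also have "\<dots> = m k \<omega> powr p" using m_nonneg[of k \<omega>] powr_add[of "m k \<omega>" "p - 1" 1] by simp
      finally show ?thesis .
    qed
    then show "AE \<omega> in M. norm (m k \<omega> powr (p - 1) * norm (S k \<omega>)) \<le> norm (m k \<omega> powr p)"
      by simp
  qed measurable
  have F_int: "integrable M (?F k)" for k
    using m_int mS_int by (auto simp: mult.assoc)
  have F_step: "expectation (?F (Suc k)) \<le> expectation (?F k)" for k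
  proof -
    \<comment> \<open>Where \<open>S k\<close> vanishes, division by zero gives 0, so the weighted
      vector is m^(p-1) \<open>sgn (S k \<omega>)\<close> without exception.\<close>
    let ?G = "\<lambda>a b. a powr (p - 1) / b :: real"
    let ?W = "\<lambda>\<omega>. (?G (m k \<omega>) (norm (S k \<omega>)) *\<^sub>R S k \<omega>) \<bullet> D (Suc k) \<omega>"
    have z: "integrable M ?W" "expectation ?W = 0"
      by (rule zero; auto)+
    have "?F (Suc k) \<omega> \<le> ?F k \<omega> - p * ?W \<omega>" for \<omega>
    proof -
      \<comment> \<open>\<open>sgn\<close> of \<open>S k\<close> is a subgradient of the norm there;
        as the next increment is centred and independent, the norms form a submartingale.\<close>
      have "norm (S k \<omega>) + sgn (S k \<omega>) \<bullet> D (Suc k) \<omega> \<le> norm (S (Suc k) \<omega>)"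
      proof (cases "S k \<omega> = 0")
        case False
        have "norm (S k \<omega>) + sgn (S k \<omega>) \<bullet> D (Suc k) \<omega> = sgn (S k \<omega>) \<bullet> S (Suc k) \<omega>"
          using False by (simp add: S_Suc inner_add_right sgn_div_norm power2_norm_eq_inner[symmetric] power2_eq_square field_simps)
        also have "\<dots> \<le> norm (sgn (S k \<omega>)) * norm (S (Suc k) \<omega>)" by (rule norm_cauchy_schwarz)
        finally show ?thesis using False by (simp add: norm_sgn)
      qed simp
      then have "m k \<omega> powr (p - 1) * (norm (S k \<omega>) + sgn (S k \<omega>) \<bullet> D (Suc k) \<omega>) \<le> m k \<omega> powr (p - 1) * norm (S (Suc k) \<omega>)"
        by (intro mult_left_mono) auto
      moreover have "?W \<omega> = m k \<omega> powr (p - 1) * (sgn (S k \<omega>) \<bullet> D (Suc k) \<omega>)"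
        by (simp add: sgn_div_norm divide_inverse mult.assoc)
      ultimately have "m k \<omega> powr (p - 1) * norm (S k \<omega>) + ?W \<omega> \<le> m k \<omega> powr (p - 1) * norm (S (Suc k) \<omega>)"
        by (metis distrib_left)
      then have "p * (m k \<omega> powr (p - 1) * norm (S k \<omega>) + ?W \<omega>) \<le> p * (m k \<omega> powr (p - 1) * norm (S (Suc k) \<omega>))"
        using p by (intro mult_left_mono) auto
      then have "p * m k \<omega> powr (p - 1) * norm (S k \<omega>) + p * ?W \<omega> \<le> p * m k \<omega> powr (p - 1) * norm (S (Suc k) \<omega>)"
        by (simp only: distrib_left mult.assoc)
      moreover have "?F (Suc k) \<omega> \<le> (p - 1) * m k \<omega> powr p - p * m k \<omega> powr (p - 1) * norm (S (Suc k) \<omega>)"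
        unfolding m_Suc using m_nonneg p by (intro doob_potential_step) auto
      ultimately show ?thesis by linarith
    qed
    then have "expectation (?F (Suc k)) \<le> expectation (\<lambda>\<omega>. ?F k \<omega> - p * ?W \<omega>)"
      by (intro integral_mono[OF F_int Bochner_Integration.integrable_diff[OF F_int integrable_mult_right[OF z(1)]]])
    also have "\<dots> = expectation (?F k)"
      unfolding Bochner_Integration.integral_diff[OF F_int integrable_mult_right[OF z(1)]]
        integral_mult_right_zero z(2) by (rule trans[OF _ diff_zero]) simp
    finally show ?thesis .
  qed
  have F_le: "expectation (?F k) \<le> 0" for k
  proof (induction k)
    case 0
    show ?case using p by (simp add: m_def' S_def)
  next
    case (Suc k)
    with F_step[of k] show ?case by linarith
  qed
  show "expectation (\<lambda>\<omega>. m n \<omega> powr p)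
      \<le> 2 powr p * C * exp C * real n powr (p / 2 - 1) * (\<Sum>j=1..n. expectation (\<lambda>\<omega>. norm (D j \<omega>) powr p))"
  proof (cases "n = 0")
    case True
    then show ?thesis by (simp add: m_def' S_def)
  next
    case False
    \<comment> \<open>This choice bounds (1 + C h)^n by exp C and turns h^(1-p/2) into
      n^(p/2-1).\<close>
    define h where "h = 1 / real n"
    have h: "0 < h" "h \<le> 1" using False by (auto simp: h_def)
    have "expectation (\<lambda>\<omega>. m n \<omega> powr p) \<le> expectation (\<lambda>\<omega>. 2 powr p * norm (S n \<omega>) powr p + 2 * ?F n \<omega>)"
    proof (rule integral_mono)
      show "integrable M (\<lambda>\<omega>. 2 powr p * norm (S n \<omega>) powr p + 2 * ?F n \<omega>)"
        by (intro Bochner_Integration.integrable_add integrable_mult_right F_int S_int)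
      show "m n \<omega> powr p \<le> 2 powr p * norm (S n \<omega>) powr p + 2 * ?F n \<omega>" for \<omega>
        using p m_nonneg by (intro doob_potential_ge) auto
    qed (rule m_int)
    also have "\<dots> = 2 powr p * expectation (\<lambda>\<omega>. norm (S n \<omega>) powr p) + 2 * expectation (?F n)"
      unfolding Bochner_Integration.integral_add[OF integrable_mult_right[OF S_int] integrable_mult_right[OF F_int]]
        integral_mult_right_zero ..
    also have "\<dots> \<le> 2 powr p * expectation (\<lambda>\<omega>. norm (S n \<omega>) powr p)"
      using F_le[of n] by simp
    also have "\<dots> \<le> 2 powr p * ((1 + C * h) ^ n * (C * h powr (1 - p / 2) * (\<Sum>j=1..n. \<delta> j)))"
      using moment[OF h] by (intro mult_left_mono) auto
    also have "\<dots> \<le> 2 powr p * (exp C * (C * h powr (1 - p / 2) * (\<Sum>j=1..n. \<delta> j)))"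
    proof (intro mult_left_mono mult_right_mono)
      have "(1 + C * h) ^ n \<le> exp (C * h) ^ n" using C h by (intro power_mono exp_ge_add_one_self) auto
      also have "\<dots> = exp C" using False by (simp add: h_def exp_of_nat_mult[symmetric])
      finally show "(1 + C * h) ^ n \<le> exp C" .
    qed (auto simp: C \<delta>_def intro!: mult_nonneg_nonneg sum_nonneg Bochner_Integration.integral_nonneg)
    also have "h powr (1 - p / 2) = real n powr (p / 2 - 1)"
      using False by (simp add: h_def powr_divide powr_minus_divide[symmetric])
    finally show ?thesis by (simp add: \<delta>_def mult_ac)
  qed
qed

section \<open>Uniform sampling points and the discrete Gronwall lemma\<close>

text \<open>The product of the factors 1 + c_k solves the recursion with equality and dominates
  \<open>x\<close> by strong induction. Finiteness of \<open>x\<close> is part of the conclusion and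
  not assumed.\<close>

lemma discrete_gronwall_ennreal:
  fixes x :: "nat \<Rightarrow> ennreal" and a :: real and c :: "nat \<Rightarrow> real"
  assumes "0 \<le> a" "\<And>i. 0 \<le> c i"
    and x: "\<And>n. n \<le> N \<Longrightarrow> x n \<le> ennreal a + (\<Sum>i<n. ennreal (c i) * x i)"
    and "n \<le> N"
  shows "x n \<le> ennreal (a * exp (\<Sum>i<n. c i))"
proof -
  define P where "P n = (\<Prod>k<n. 1 + c k)" for n
  have P: "P n = 1 + (\<Sum>i<n. c i * P i)" for n
    by (induction n) (auto simp: P_def algebra_simps)
  have P_nonneg: "0 \<le> P n" for n unfolding P_def using assms by (intro prod_nonneg) auto
  have "x n \<le> ennreal (a * P n)" using \<open>n \<le> N\<close>
  proof (induction n rule: less_induct)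
    case (less n)
    have "x n \<le> ennreal a + (\<Sum>i<n. ennreal (c i) * x i)" using less.prems by (rule x)
    also have "\<dots> \<le> ennreal a + (\<Sum>i<n. ennreal (c i) * ennreal (a * P i))"
      using less by (intro add_left_mono sum_mono mult_left_mono) auto
    also have "\<dots> = ennreal a + (\<Sum>i<n. ennreal (c i * (a * P i)))"
      using assms by (simp add: ennreal_mult')
    also have "\<dots> = ennreal (a + (\<Sum>i<n. c i * (a * P i)))"
      using assms P_nonneg by (subst sum_ennreal) (auto simp: sum_nonneg)
    also have "a + (\<Sum>i<n. c i * (a * P i)) = a * P n"
      by (subst P[of n]) (simp add: algebra_simps sum_distrib_left)
    finally show ?case .
  qed
  also have "a * P n \<le> a * exp (\<Sum>i<n. c i)"
    unfolding P_def exp_sum[OF finite_lessThan] using assms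
    by (intro mult_left_mono prod_mono conjI exp_ge_add_one_self) (auto intro: add_nonneg_nonneg)
  finally show ?thesis by (simp add: ennreal_leI)
qed

text \<open>The open steps are disjoint. This turns step-wise weights into global integrals and so
  keeps the Gronwall exponent free of \<open>h\<close>.\<close>

lemma sum_set_integral_grid_le:
  fixes \<phi> :: "real \<Rightarrow> real"
  assumes "0 < h" "integrable lborel \<phi>" "\<And>s. 0 \<le> \<phi> s"
  shows "(\<Sum>i<n. LINT s:{real i * h<..<real i * h + h}|lborel. \<phi> s) \<le> (LINT s|lborel. \<phi> s)"
proof -
  let ?I = "\<lambda>i. {real i * h<..<real i * h + h}"
  have int: "set_integrable lborel (?I i) \<phi>" for i
    using assms unfolding set_integrable_def by (intro integrable_mult_indicator) auto
  have "disjoint_family_on ?I {..<n}"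
  proof -
    have "?I i \<inter> ?I k = {}" if "i < k" for i k :: nat
    proof -
      have "(real i + 1) * h \<le> real k * h" using that assms by (intro mult_right_mono) auto
      then show ?thesis by (auto simp: algebra_simps)
    qed
    then show ?thesis unfolding disjoint_family_on_def by (metis Int_commute linorder_neqE_nat)
  qed
  then have ind: "(\<Sum>i<n. indicator (?I i) s) = (indicator (\<Union>i<n. ?I i) s :: real)" for s
    by (subst indicator_UN_disjoint) auto
  have "(\<Sum>i<n. LINT s:?I i|lborel. \<phi> s) = (LINT s|lborel. (\<Sum>i<n. indicator (?I i) s *\<^sub>R \<phi> s))"
    using int unfolding set_lebesgue_integral_def set_integrable_def
    by (subst Bochner_Integration.integral_sum) auto
  also have "\<dots> \<le> (LINT s|lborel. \<phi> s)"
  proof (intro integral_mono Bochner_Integration.integrable_sum)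
    fix s
    have "(\<Sum>i<n. indicator (?I i) s *\<^sub>R \<phi> s) = indicator (\<Union>i<n. ?I i) s * \<phi> s"
      by (simp only: real_scaleR_def sum_distrib_right[symmetric] ind)
    also have "\<dots> \<le> \<phi> s" using assms(3)[of s] by (simp add: indicator_def)
    finally show "(\<Sum>i<n. indicator (?I i) s *\<^sub>R \<phi> s) \<le> \<phi> s" .
  qed (use int assms in \<open>auto simp: set_integrable_def\<close>)
  finally show ?thesis .
qed

section \<open>Laws and expectations at uniform sampling points\<close>

context prob_space begin

lemma distr_uniform_affine:
  assumes [measurable]: "X \<in> borel_measurable M"
    and X: "distr M borel X = uniform_measure lborel {0<..<1}" and h: "(0::real) < h"
  shows "distr M borel (\<lambda>\<omega>. a + X \<omega> * h) = uniform_measure lborel {a<..<a + h}"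
proof (rule measure_eqI)
  fix A assume "A \<in> sets (distr M borel (\<lambda>\<omega>. a + X \<omega> * h))"
  then have [measurable]: "A \<in> sets borel" by simp
  define V where "V = (\<lambda>x. a + x * h) -` A"
  have [measurable]: "V \<in> sets borel" unfolding V_def by (rule measurable_sets_borel[OF _ \<open>A \<in> sets borel\<close>]) measurable
  have "emeasure (distr M borel (\<lambda>\<omega>. a + X \<omega> * h)) A = emeasure (distr M borel X) V"
    by (simp add: emeasure_distr V_def vimage_def)
  also have "\<dots> = emeasure lborel ({0<..<1} \<inter> V)"
    unfolding X by (simp add: divide_ennreal_def)
  also have "\<dots> = (\<integral>\<^sup>+x. indicator ({0<..<1} \<inter> V) x \<partial>lborel)"
    by (rule nn_integral_indicator[symmetric]) simp
  also have "\<dots> = (\<integral>\<^sup>+x. indicator ({a<..<a + h} \<inter> A) (a + h * x) \<partial>lborel)"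
    using h by (intro nn_integral_cong)
      (auto simp: indicator_def V_def mult.commute[of _ h] zero_less_mult_iff)
  also have "\<dots> = emeasure lborel ({a<..<a + h} \<inter> A) / ennreal h"
  proof -
    have "emeasure lborel ({a<..<a + h} \<inter> A)
        = (\<integral>\<^sup>+x. indicator ({a<..<a + h} \<inter> A) (a + h * x) \<partial>lborel) * ennreal h"
      using nn_integral_real_affine[of "indicator ({a<..<a + h} \<inter> A)" h a] h
      by (simp add: mult.commute[of "ennreal h"])
    then show ?thesis using h by (simp add: ennreal_mult_divide_eq)
  qed
  also have "\<dots> = emeasure (uniform_measure lborel {a<..<a + h}) A"
    using h by simp
  finally show "emeasure (distr M borel (\<lambda>\<omega>. a + X \<omega> * h)) A = emeasure (uniform_measure lborel {a<..<a + h}) A" .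
qed simp

text \<open>The law of the sampling point is absolutely continuous, so exceptional null sets in time
  are hit with probability zero.\<close>

lemma AE_uniform_distr:
  fixes a h :: real
  assumes X: "X \<in> borel_measurable M" "distr M borel X = uniform_measure lborel {a<..<a + h}"
    and P: "AE x in lborel. x \<in> {a<..<a + h} \<longrightarrow> P x"
  shows "AE \<omega> in M. P (X \<omega>)"
proof (rule AE_distrD[OF X(1)])
  show "AE x in distr M borel X. P x"
    unfolding X(2) using P by (intro AE_uniform_measureI) auto
qed

text \<open>Unbiasedness of the uniform node: its density 1/h cancels the factor \<open>h\<close>.
  Vector values are needed for \<open>g\<close> itself, real ones for |g|, |g|^p and L^p.\<close>

lemma
  fixes \<phi> :: "real \<Rightarrow> 'b::{banach, second_countable_topology}" and a h :: real
  assumes [measurable]: "X \<in> borel_measurable M"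
    and X: "distr M borel X = uniform_measure lborel {a<..<a + h}" and h: "0 < h"
    and int: "integrable lborel \<phi>"
  shows integrable_uniform_distr: "integrable M (\<lambda>\<omega>. \<phi> (X \<omega>))"
    and expectation_uniform_distr: "h *\<^sub>R expectation (\<lambda>\<omega>. \<phi> (X \<omega>)) = (LINT s:{a<..<a + h}|lborel. \<phi> s)"
proof -
  let ?I = "{a<..<a + h}"
  have [measurable]: "\<phi> \<in> borel_measurable borel" using borel_measurable_integrable[OF int] by simp
  have U: "uniform_measure lborel ?I = density lborel (\<lambda>x. ennreal (indicator ?I x / h))"
    unfolding uniform_measure_def using h
    by (intro arg_cong[where f = "density lborel"]) (auto simp: indicator_def fun_eq_iff divide_ennreal[symmetric])
  have eq: "(\<lambda>x. (indicator ?I x / h) *\<^sub>R \<phi> x) = (\<lambda>x. (1 / h) *\<^sub>R (indicator ?I x *\<^sub>R \<phi> x))"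
    by auto
  have "integrable lborel (\<lambda>x. indicator ?I x *\<^sub>R \<phi> x)"
    using int by (intro integrable_mult_indicator) auto
  then have "integrable lborel (\<lambda>x. (indicator ?I x / h) *\<^sub>R \<phi> x)"
    unfolding eq by (rule integrable_scaleR_right)
  then have "integrable (distr M borel X) \<phi>"
    unfolding X U using h by (subst integrable_density) auto
  then show "integrable M (\<lambda>\<omega>. \<phi> (X \<omega>))" by (subst (asm) integrable_distr_eq) auto
  have "expectation (\<lambda>\<omega>. \<phi> (X \<omega>)) = integral\<^sup>L (distr M borel X) \<phi>"
    by (subst integral_distr) auto
  also have "\<dots> = (1 / h) *\<^sub>R (LINT s:?I|lborel. \<phi> s)"
    unfolding X U set_lebesgue_integral_def integral_scaleR_right[symmetric] eq[symmetric]
    using h by (intro integral_density) auto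
  finally show "h *\<^sub>R expectation (\<lambda>\<omega>. \<phi> (X \<omega>)) = (LINT s:?I|lborel. \<phi> s)"
    using h by simp
qed

end

section \<open>Measurability of the scheme and the pathwise error recursion\<close>

lemma rand_euler_cong:
  assumes "\<And>j. 1 \<le> j \<Longrightarrow> j \<le> n \<Longrightarrow> d j = d' j"
  shows "rand_euler f u\<^sub>0 h d n = rand_euler f u\<^sub>0 h d' n"
  using assms
proof (induction n)
  case (Suc n)
  have "rand_euler f u\<^sub>0 h d n = rand_euler f u\<^sub>0 h d' n" "d (Suc n) = d' (Suc n)"
    by (intro Suc.IH Suc.prems; simp)+
  then show ?case by simp
qed simp

text \<open>\<open>J\<close> may exceed \<open>{1..n}\<close>, so that all iterates up to some index
  live on one product space and their maximal error can be formed there.\<close>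

lemma measurable_rand_euler:
  fixes f :: "real \<Rightarrow> real ^ 'd \<Rightarrow> real ^ 'd"
  assumes f [measurable]: "(\<lambda>(t, x). f t x) \<in> borel_measurable (borel \<Otimes>\<^sub>M borel)"
    and "{1..n} \<subseteq> J"
  shows "(\<lambda>d. rand_euler f u\<^sub>0 h d n) \<in> borel_measurable (\<Pi>\<^sub>M j\<in>J. borel)"
  using assms(2)
proof (induction n)
  case (Suc n)
  have "{1..n} \<subseteq> J" by (rule order_trans[OF _ Suc.prems]) simp
  then have [measurable]: "(\<lambda>d. rand_euler f u\<^sub>0 h d n) \<in> borel_measurable (\<Pi>\<^sub>M j\<in>J. borel)" by (rule Suc.IH)
  have [measurable]: "(\<lambda>d. d (Suc n)) \<in> borel_measurable (\<Pi>\<^sub>M j\<in>J. (borel :: real measure))"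
    using Suc.prems by (intro measurable_component_singleton) auto
  show ?case by simp
qed simp

text \<open>Replacing \<open>norm (e i)\<close> by the running maximum makes the recursion close on
  itself. The power of the sum costs n^(p-1); 4^p is one 2^p for separating \<open>S\<close> from
  the sum and one for separating \<open>b i\<close> from the error. The weights \<open>c i\<close>
  stay inside the sum because they are random in the application.\<close>

lemma error_recursion_powr:
  fixes e S :: "nat \<Rightarrow> 'b::real_normed_vector" and c b :: "nat \<Rightarrow> real"
  assumes p: "1 \<le> p" and c: "\<And>i. 0 \<le> c i" and b: "\<And>i. 0 \<le> b i"
    and e: "\<And>k. k \<le> n \<Longrightarrow> norm (e k) \<le> norm (S k) + (\<Sum>i<k. c i * (b i + norm (e i)))"
  shows "Max ((\<lambda>k. norm (e k)) ` {0..n}) powr p \<le> 2 powr p * Max ((\<lambda>k. norm (S k)) ` {0..n}) powr p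
    + (\<Sum>i<n. 4 powr p * (real n powr (p - 1) * c i powr p) * (b i powr p + Max ((\<lambda>k. norm (e k)) ` {0..i}) powr p))"
proof -
  let ?E = "\<lambda>i. Max ((\<lambda>k. norm (e k)) ` {0..i})"
  let ?M = "Max ((\<lambda>k. norm (S k)) ` {0..n})"
  have "norm (e k) \<le> ?M + (\<Sum>i<n. c i * (b i + ?E i))" if k: "k \<le> n" for k
  proof -
    have "norm (e k) \<le> norm (S k) + (\<Sum>i<k. c i * (b i + norm (e i)))" using k by (rule e)
    also have "(\<Sum>i<k. c i * (b i + norm (e i))) \<le> (\<Sum>i<k. c i * (b i + ?E i))"
      using c by (intro sum_mono mult_left_mono add_left_mono Max_ge) auto
    also have "\<dots> \<le> (\<Sum>i<n. c i * (b i + ?E i))"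
      using k c b Max_norm_nonneg[of e] by (intro sum_mono2) auto
    also have "norm (S k) \<le> ?M" using k by (intro Max_ge) auto
    finally show ?thesis by simp
  qed
  then have "?E n \<le> ?M + (\<Sum>i<n. c i * (b i + ?E i))" by (subst Max_le_iff) auto
  then have "?E n powr p \<le> (?M + (\<Sum>i<n. c i * (b i + ?E i))) powr p"
    using p Max_norm_nonneg[of e] by (intro powr_mono2) auto
  also have "\<dots> \<le> 2 powr p * (?M powr p + (\<Sum>i<n. c i * (b i + ?E i)) powr p)"
    using p b c Max_norm_nonneg[of e] Max_norm_nonneg[of S] by (intro powr_add_le) (auto intro!: sum_nonneg)
  finally have E_le: "?E n powr p \<le> 2 powr p * (?M powr p + (\<Sum>i<n. c i * (b i + ?E i)) powr p)" .
  have "(\<Sum>i<n. c i * (b i + ?E i)) powr p \<le> real n powr (p - 1) * (\<Sum>i<n. (c i * (b i + ?E i)) powr p)"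
    using powr_sum_le[of "{..<n}" "\<lambda>i. c i * (b i + ?E i)" p] p b c Max_norm_nonneg[of e] by simp
  also have "\<dots> \<le> real n powr (p - 1) * (\<Sum>i<n. c i powr p * (2 powr p * (b i powr p + ?E i powr p)))"
  proof (intro mult_left_mono sum_mono)
    fix i
    have "(c i * (b i + ?E i)) powr p = c i powr p * (b i + ?E i) powr p"
      using b c Max_norm_nonneg[of e] by (simp add: powr_mult)
    also have "\<dots> \<le> c i powr p * (2 powr p * (b i powr p + ?E i powr p))"
      using b p Max_norm_nonneg[of e] by (intro mult_left_mono powr_add_le) auto
    finally show "(c i * (b i + ?E i)) powr p \<le> c i powr p * (2 powr p * (b i powr p + ?E i powr p))" .
  qed simp
  finally have "2 powr p * (?M powr p + (\<Sum>i<n. c i * (b i + ?E i)) powr p) \<le> 2 powr p * (?M powr p + real n powr (p - 1) *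
      (\<Sum>i<n. c i powr p * (2 powr p * (b i powr p + ?E i powr p))))"
    by (intro mult_left_mono add_left_mono) auto
  note order_trans[OF E_le this]
  also have "\<dots> = 2 powr p * ?M powr p + (\<Sum>i<n. (2 powr p * 2 powr p) * (real n powr (p - 1) * c i powr p) * (b i powr p + ?E i powr p))"
    by (simp add: distrib_left sum_distrib_left mult_ac)
  also have "2 powr p * 2 powr p = (4 powr p :: real)"
    by (subst powr_mult[symmetric]) auto
  finally show ?thesis .
qed

section \<open>The error for a Borel measurable right-hand side\<close>

lemma set_integral_increment:
  fixes g :: "real \<Rightarrow> 'b::euclidean_space"
  assumes g: "integrable lborel g" and "0 \<le> a" "a \<le> t"
  shows "(LINT s:{0..t}|lborel. g s) - (LINT s:{0..a}|lborel. g s) = (LINT s:{a<..<t}|lborel. g s)"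
proof -
  have int: "set_integrable lborel A g" if "A \<in> sets borel" for A
    using g that unfolding set_integrable_def by (intro integrable_mult_indicator) auto
  have [measurable]: "g \<in> borel_measurable borel" using borel_measurable_integrable[OF g] by simp
  have "{0..t} = {0..a} \<union> {a<..t}" using assms by auto
  then have "(LINT s:{0..t}|lborel. g s) = (LINT s:{0..a}|lborel. g s) + (LINT s:{a<..t}|lborel. g s)"
    using set_integral_Un[of "{0..a}" "{a<..t}" lborel g] int by (simp add: disjoint_iff)
  moreover have "(LINT s:{a<..t}|lborel. g s) = (LINT s:{a<..<t}|lborel. g s)"
    unfolding set_lebesgue_integral_def
  proof (rule integral_cong_AE)
    show "AE s in lborel. indicator {a<..t} s *\<^sub>R g s = indicator {a<..<t} s *\<^sub>R g s"
      using AE_lborel_singleton[of t] by eventually_elim (auto simp: indicator_def)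
  qed measurable
  ultimately show ?thesis by simp
qed

lemma set_integral_null_singleton:
  fixes g :: "real \<Rightarrow> 'b::euclidean_space"
  shows "(LINT s:{a}|lborel. g s) = 0"
proof -
  have "AE s in lborel. indicator {a} s *\<^sub>R g s = 0"
    using AE_lborel_singleton[of a] by eventually_elim auto
  then show ?thesis unfolding set_lebesgue_integral_def by (rule integral_eq_zero_AE)
qed

lemma norm_set_integral_le_superset:
  fixes g :: "'a \<Rightarrow> 'b::euclidean_space"
  assumes g: "integrable M g" and [measurable]: "A \<in> sets M" "B \<in> sets M" and "A \<subseteq> B"
  shows "norm (LINT s:A|M. g s) \<le> (LINT s:B|M. norm (g s))"
proof -
  have "norm (LINT s:A|M. g s) \<le> (LINT s|M. norm (indicator A s *\<^sub>R g s))"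
    unfolding set_lebesgue_integral_def by (rule integral_norm_bound)
  also have "\<dots> \<le> (LINT s:B|M. norm (g s))"
    unfolding set_lebesgue_integral_def using g \<open>A \<subseteq> B\<close>
    by (intro integral_mono integrable_norm integrable_mult_indicator) (auto simp: indicator_def)
  finally show ?thesis .
qed

text \<open>The core estimate, with all bounds on \<open>f\<close> valid everywhere. Apart from
  h^(p/2), the constant involves only \<open>T\<close>, \<open>p\<close> and the global integrals
  \<open>Q\<close> and \<open>\<Lambda>\<close>, so it can be fixed before \<open>h\<close>.\<close>

lemma (in prob_space) rand_euler_error_borel:
  fixes f :: "real \<Rightarrow> real ^ 'd \<Rightarrow> real ^ 'd" and u :: "real \<Rightarrow> real ^ 'd" and L :: "real \<Rightarrow> real"
    and \<tau> :: "nat \<Rightarrow> 'a \<Rightarrow> real" and T p h :: real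
  assumes p: "2 \<le> p" and T: "0 < T"
    and ind: "indep_vars (\<lambda>_. borel) \<tau> {1..}"
    and unif: "\<And>j. 1 \<le> j \<Longrightarrow> distr M borel (\<tau> j) = uniform_measure lborel {0<..<1}"
    and f_meas [measurable]: "(\<lambda>(t, x). f t x) \<in> borel_measurable (borel \<Otimes>\<^sub>M borel)"
    and L_meas [measurable]: "L \<in> borel_measurable borel"
    and L_nonneg: "\<And>t. 0 \<le> L t"
    and lip: "\<And>t x y. norm (f t x - f t y) \<le> L t * norm (x - y)"
    and g_int: "integrable lborel (\<lambda>s. f s (u s))"
    and gp_int: "integrable lborel (\<lambda>s. norm (f s (u s)) powr p)"
    and Lp_int: "integrable lborel (\<lambda>s. L s powr p)"
    and u: "\<And>t. t \<in> {0..T} \<Longrightarrow> u t = u\<^sub>0 + (LINT s:{0..t}|lborel. f s (u s))"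
    and h: "0 < h" "h < 1" and N: "real N * h \<le> T"
  defines "Q \<equiv> LINT s|lborel. norm (f s (u s)) powr p"
    and "\<Lambda> \<equiv> LINT s|lborel. L s powr p"
    and "C \<equiv> p\<^sup>2 * (2 powr p + 1)"
    and "B \<equiv> 4 powr p * T powr (p - 1)"
  shows "(\<integral>\<^sup>+\<omega>. ennreal (Max ((\<lambda>n. norm (u (real n * h) - rand_euler f u\<^sub>0 h (\<lambda>j. \<tau> j \<omega>) n)) ` {0..N}) powr p) \<partial>M)
    \<le> ennreal ((2 powr p * (2 powr p * C * exp C) * T powr (p / 2 - 1) * (2 * 2 powr p) + B * \<Lambda>) * Q
        * exp (B * \<Lambda>) * h powr (p / 2))"
proof -
  define g where "g s = f s (u s)" for s
  define I where "I i = {real i * h<..<real i * h + h}" for i :: nat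
  define \<theta> where "\<theta> i \<omega> = real i * h + \<tau> (Suc i) \<omega> * h" for i \<omega>
  \<comment> \<open>The sampling variables start at index 1, so entry \<open>j\<close> belongs to
    step \<open>j - 1\<close>. Writing the error as a deterministic function of
    \<open>\<tau> j\<close> transfers independence to \<open>D\<close>.\<close>
  define G where "G j x = (LINT s:I (j - 1)|lborel. g s) - h *\<^sub>R g (real (j - 1) * h + x * h)" for j x
  define D where "D j \<omega> = G j (\<tau> j \<omega>)" for j \<omega>
  define U where "U d n = rand_euler f u\<^sub>0 h d n" for d n
  define e where "e d n = u (real n * h) - U d n" for d n
  define E where "E n d = Max ((\<lambda>k. norm (e d k)) ` {0..n})" for n d
  define b where "b i = (LINT s:I i|lborel. norm (g s))" for i
  define q where "q i = (LINT s:I i|lborel. norm (g s) powr p)" for i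
  define l where "l i = (LINT s:I i|lborel. L s powr p)" for i
  define S where "S k \<omega> = (\<Sum>j=1..k. D j \<omega>)" for k \<omega>
  define m where "m n \<omega> = Max ((\<lambda>k. norm (S k \<omega>)) ` {0..n})" for n \<omega>
  note g_int = g_int[folded g_def] and gp_int = gp_int[folded g_def]
  note Q_def = Q_def[folded g_def]
  have B: "0 \<le> B" by (simp add: B_def)
  have C: "0 \<le> C" by (simp add: C_def)
  have Q: "0 \<le> Q" unfolding Q_def by (intro Bochner_Integration.integral_nonneg) auto
  have \<Lambda>: "0 \<le> \<Lambda>" unfolding \<Lambda>_def by (intro Bochner_Integration.integral_nonneg) auto
  have [measurable]: "g \<in> borel_measurable borel" using borel_measurable_integrable[OF g_int] by simp
  have \<tau>_meas: "\<tau> j \<in> borel_measurable M" if "1 \<le> j" for j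
    using ind that by (auto simp: indep_vars_def)
  have [measurable]: "\<tau> (Suc i) \<in> borel_measurable M" for i by (rule \<tau>_meas) simp
  have \<theta>_meas [measurable]: "\<theta> i \<in> borel_measurable M" for i unfolding \<theta>_def[abs_def] by measurable
  have \<theta>_distr: "distr M borel (\<theta> i) = uniform_measure lborel {real i * h<..<real i * h + h}" for i
    unfolding \<theta>_def[abs_def] using h by (intro distr_uniform_affine unif) auto
  note \<theta>_integrable = integrable_uniform_distr[OF \<theta>_meas \<theta>_distr h(1)]
    and \<theta>_expectation = expectation_uniform_distr[OF \<theta>_meas \<theta>_distr h(1), folded I_def]
  have q_sum: "(\<Sum>i<n. q i) \<le> Q" for n
    unfolding q_def I_def Q_def by (intro sum_set_integral_grid_le h gp_int) auto
  have l_sum: "(\<Sum>i<n. l i) \<le> \<Lambda>" for n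
    unfolding l_def I_def \<Lambda>_def by (intro sum_set_integral_grid_le h Lp_int) auto
  have q_nonneg: "0 \<le> q i" for i
    unfolding q_def set_lebesgue_integral_def by (intro Bochner_Integration.integral_nonneg) auto
  have l_nonneg: "0 \<le> l i" for i
    unfolding l_def set_lebesgue_integral_def by (intro Bochner_Integration.integral_nonneg) auto
  have b_nonneg: "0 \<le> b i" for i
    unfolding b_def set_lebesgue_integral_def by (intro Bochner_Integration.integral_nonneg) auto
  have q_le: "q i \<le> Q" for i
  proof -
    have "q i \<le> (\<Sum>k<Suc i. q k)" using q_nonneg by (intro member_le_sum) auto
    with q_sum[of "Suc i"] show ?thesis by linarith
  qed
  \<comment> \<open>Here p - 1 \<ge> p/2, that is p \<ge> 2, and h < 1 enter: the local terms are no
    worse than the sampling error.\<close>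
  have hp: "h powr (p - 1) \<le> h powr (p / 2)"
    using h p by (intro powr_mono') auto
  have hpow: "h powr p = h powr (p - 1) * h"
    using h powr_add[of h "p - 1" 1] by simp
  have Eg_le: "expectation (\<lambda>\<omega>. norm (g (\<theta> i \<omega>))) powr p \<le> expectation (\<lambda>\<omega>. norm (g (\<theta> i \<omega>)) powr p)" for i
    using p \<theta>_integrable[OF integrable_norm[OF g_int]] \<theta>_integrable[OF gp_int]
    by (intro expectation_powr_le) auto
  have Egp: "h * expectation (\<lambda>\<omega>. norm (g (\<theta> i \<omega>)) powr p) = q i" for i
    using \<theta>_expectation[OF gp_int, of i] by (simp add: q_def)
  have b_le: "b i powr p \<le> h powr (p / 2) * Q" for i
  proof -
    have "b i powr p = (h * expectation (\<lambda>\<omega>. norm (g (\<theta> i \<omega>)))) powr p"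
      using \<theta>_expectation[OF integrable_norm[OF g_int], of i] by (simp add: b_def)
    also have "\<dots> = h powr p * expectation (\<lambda>\<omega>. norm (g (\<theta> i \<omega>))) powr p"
      by (rule powr_mult)
    also have "\<dots> \<le> h powr p * expectation (\<lambda>\<omega>. norm (g (\<theta> i \<omega>)) powr p)"
      by (intro mult_left_mono Eg_le) auto
    also have "\<dots> = h powr (p - 1) * q i" by (simp add: hpow Egp[symmetric])
    also have "\<dots> \<le> h powr (p / 2) * Q" using q_le q_nonneg hp by (intro mult_mono) auto
    finally show ?thesis .
  qed
  have D_eq: "D (Suc i) \<omega> = h *\<^sub>R expectation (\<lambda>\<omega>. g (\<theta> i \<omega>)) - h *\<^sub>R g (\<theta> i \<omega>)" for i \<omega>
    using \<theta>_expectation[OF g_int, of i] by (simp add: D_def G_def \<theta>_def)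
  have Suc_ex: "\<exists>i. j = Suc i" if "1 \<le> j" for j :: nat using that by (cases j) auto
  have D_ind: "indep_vars (\<lambda>_. borel) D {1..}"
    unfolding D_def[abs_def] by (rule indep_vars_compose2[OF ind]) (simp add: G_def)
  have D_mean: "expectation (D j) = 0" if j1: "1 \<le> j" for j
  proof -
    obtain i where j: "j = Suc i" using Suc_ex[OF j1] by auto
    show ?thesis using \<theta>_integrable[OF g_int, of i] unfolding j D_eq by (simp add: prob_space)
  qed
  have D_le: "norm (D (Suc i) \<omega>) powr p \<le> (2 powr p * h powr p) *
      (expectation (\<lambda>\<omega>. norm (g (\<theta> i \<omega>)) powr p) + norm (g (\<theta> i \<omega>)) powr p)" for i \<omega>
  proof -
    have "norm (D (Suc i) \<omega>) = h * norm (expectation (\<lambda>\<omega>. g (\<theta> i \<omega>)) - g (\<theta> i \<omega>))"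
      using h unfolding D_eq scaleR_diff_right[symmetric] by simp
    also have "\<dots> \<le> h * (expectation (\<lambda>\<omega>. norm (g (\<theta> i \<omega>))) + norm (g (\<theta> i \<omega>)))"
      using h by (intro mult_left_mono order_trans[OF norm_triangle_ineq4] add_right_mono integral_norm_bound) auto
    finally have "norm (D (Suc i) \<omega>) powr p \<le> (h * (expectation (\<lambda>\<omega>. norm (g (\<theta> i \<omega>))) + norm (g (\<theta> i \<omega>)))) powr p"
      using p by (intro powr_mono2) auto
    also have "\<dots> = h powr p * (expectation (\<lambda>\<omega>. norm (g (\<theta> i \<omega>))) + norm (g (\<theta> i \<omega>))) powr p"
      by (rule powr_mult)
    also have "\<dots> \<le> h powr p * (2 powr p * (expectation (\<lambda>\<omega>. norm (g (\<theta> i \<omega>))) powr p + norm (g (\<theta> i \<omega>)) powr p))"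
      using p by (intro mult_left_mono powr_add_le) (auto intro!: Bochner_Integration.integral_nonneg)
    also have "\<dots> \<le> h powr p * (2 powr p * (expectation (\<lambda>\<omega>. norm (g (\<theta> i \<omega>)) powr p) + norm (g (\<theta> i \<omega>)) powr p))"
      by (intro mult_left_mono add_right_mono Eg_le) auto
    finally show ?thesis by (simp only: mult_ac)
  qed
  have bound_int: "integrable M (\<lambda>\<omega>. (2 powr p * h powr p) *
      (expectation (\<lambda>\<omega>. norm (g (\<theta> i \<omega>)) powr p) + norm (g (\<theta> i \<omega>)) powr p))" for i
    using \<theta>_integrable[OF gp_int, of i] by (intro integrable_mult_right Bochner_Integration.integrable_add) auto
  have [measurable]: "D (Suc i) \<in> borel_measurable M" for i unfolding D_eq by measurable
  have D_int': "integrable M (\<lambda>\<omega>. norm (D (Suc i) \<omega>) powr p)" for i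
  proof (rule Bochner_Integration.integrable_bound[OF bound_int[of i]])
    show "AE \<omega> in M. norm (norm (D (Suc i) \<omega>) powr p) \<le> norm ((2 powr p * h powr p) *
      (expectation (\<lambda>\<omega>. norm (g (\<theta> i \<omega>)) powr p) + norm (g (\<theta> i \<omega>)) powr p))"
      unfolding real_norm_def by (intro AE_I2 order_trans[OF _ abs_ge_self]) (simp only: abs_of_nonneg powr_ge_zero D_le)
  qed measurable
  have D_int: "integrable M (\<lambda>\<omega>. norm (D j \<omega>) powr p)" if "1 \<le> j" for j
    using D_int' Suc_ex[OF that] by auto
  \<comment> \<open>The centring term and the sampled value contribute the same mean, hence the
    leading 2; \<open>h\<close> times that mean is \<open>q i\<close>.\<close>
  have D_moment: "expectation (\<lambda>\<omega>. norm (D (Suc i) \<omega>) powr p) \<le> 2 * 2 powr p * h powr (p - 1) * q i" for i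
  proof -
    have "expectation (\<lambda>\<omega>. norm (D (Suc i) \<omega>) powr p) \<le> expectation (\<lambda>\<omega>. (2 powr p * h powr p) *
      (expectation (\<lambda>\<omega>. norm (g (\<theta> i \<omega>)) powr p) + norm (g (\<theta> i \<omega>)) powr p))"
      by (intro integral_mono D_le D_int' bound_int)
    also have "\<dots> = 2 * 2 powr p * h powr (p - 1) * (h * expectation (\<lambda>\<omega>. norm (g (\<theta> i \<omega>)) powr p))"
      using \<theta>_integrable[OF gp_int, of i] by (simp add: prob_space hpow)
    finally show ?thesis unfolding Egp .
  qed
  have m_eq: "m n \<omega> = Max ((\<lambda>k. norm (\<Sum>j=1..k. D j \<omega>)) ` {0..n})" for n \<omega>
    by (simp add: m_def S_def)
  have m_int: "integrable M (\<lambda>\<omega>. m n \<omega> powr p)" for n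
    unfolding m_eq by (rule expectation_max_indep_sum_powr_le(1)[OF p D_ind D_int D_mean])
  have m_moment: "expectation (\<lambda>\<omega>. m n \<omega> powr p)
      \<le> 2 powr p * C * exp C * T powr (p / 2 - 1) * (2 * 2 powr p) * h powr (p / 2) * Q" if n: "n \<le> N" for n
  proof -
    have "expectation (\<lambda>\<omega>. m n \<omega> powr p) \<le> 2 powr p * C * exp C * real n powr (p / 2 - 1) *
        (\<Sum>j=1..n. expectation (\<lambda>\<omega>. norm (D j \<omega>) powr p))"
      unfolding m_eq C_def by (rule expectation_max_indep_sum_powr_le(2)[OF p D_ind D_int D_mean])
    also have "(\<Sum>j=1..n. expectation (\<lambda>\<omega>. norm (D j \<omega>) powr p)) = (\<Sum>i<n. expectation (\<lambda>\<omega>. norm (D (Suc i) \<omega>) powr p))"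
      by (simp add: sum.atLeast1_atMost_eq)
    also have "2 powr p * C * exp C * real n powr (p / 2 - 1) * \<dots>
        \<le> 2 powr p * C * exp C * real n powr (p / 2 - 1) * (\<Sum>i<n. 2 * 2 powr p * h powr (p - 1) * q i)"
      using C by (intro mult_left_mono sum_mono D_moment) auto
    also have "\<dots> = 2 powr p * C * exp C * real n powr (p / 2 - 1) * (2 * 2 powr p * h powr (p - 1) * (\<Sum>i<n. q i))"
      by (simp add: sum_distrib_left)
    also have "\<dots> \<le> 2 powr p * C * exp C * real n powr (p / 2 - 1) * (2 * 2 powr p * h powr (p - 1) * Q)"
      using C by (intro mult_left_mono q_sum) auto
    also have "\<dots> = 2 powr p * C * exp C * (2 * 2 powr p) * Q * (real n powr (p / 2 - 1) * h powr (p - 1))"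
      by (simp only: mult_ac)
    \<comment> \<open>Since n h \<le> T, the growth n^(p/2-1) uses up the same power of
      \<open>h\<close>. What remains is h^(p/2), which is order 1/2 after the p-th root.\<close>
    also have "\<dots> \<le> 2 powr p * C * exp C * (2 * 2 powr p) * Q * (T powr (p / 2 - 1) * h powr (p / 2))"
    proof (intro mult_left_mono)
      have "h powr (p - 1) = h powr (p / 2 - 1) * h powr (p / 2)" by (simp add: powr_add[symmetric])
      then have "real n powr (p / 2 - 1) * h powr (p - 1) = (real n * h) powr (p / 2 - 1) * h powr (p / 2)"
        using h by (simp add: powr_mult)
      also have "\<dots> \<le> T powr (p / 2 - 1) * h powr (p / 2)"
        using N n h p order_trans[OF mult_right_mono[of "real n" "real N" h] N]
        by (intro mult_right_mono powr_mono2) auto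
      finally show "real n powr (p / 2 - 1) * h powr (p - 1) \<le> T powr (p / 2 - 1) * h powr (p / 2)" .
    qed (use C Q in auto)
    finally show ?thesis by (simp only: mult_ac)
  qed
  have u_step: "u (real i * h + h) - u (real i * h) = (LINT s:I i|lborel. g s)" if "i < N" for i
  proof -
    have "(real i + 1) * h \<le> real N * h" using that h by (intro mult_right_mono) auto
    then have "real i * h + h \<le> T" using N by (simp add: algebra_simps)
    then have "u (real i * h + h) - u (real i * h)
        = (LINT s:{0..real i * h + h}|lborel. g s) - (LINT s:{0..real i * h}|lborel. g s)"
      using h by (simp add: u g_def)
    also have "\<dots> = (LINT s:I i|lborel. g s)"
      unfolding I_def using h by (intro set_integral_increment g_int) auto
    finally show ?thesis .
  qed
  have u_near: "norm (u t - u (real i * h)) \<le> b i" if "i < N" "t \<in> I i" for i t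
  proof -
    have "(real i + 1) * h \<le> real N * h" using that h by (intro mult_right_mono) auto
    then have t: "t \<le> T" "0 \<le> t" "real i * h \<le> t" using N that h
      by (auto simp: I_def algebra_simps intro: order_trans[of 0 "real i * h"])
    then have "u t - u (real i * h) = (LINT s:{0..t}|lborel. g s) - (LINT s:{0..real i * h}|lborel. g s)"
      using h by (simp add: u g_def)
    also have "\<dots> = (LINT s:{real i * h<..<t}|lborel. g s)"
      using t h by (intro set_integral_increment g_int) auto
    also have "norm \<dots> \<le> b i"
      unfolding b_def using that(2) by (intro norm_set_integral_le_superset g_int) (auto simp: I_def)
    finally show ?thesis .
  qed
  let ?\<tau> = "\<lambda>\<omega> j. \<tau> j \<omega>"
  have e_eq: "e (?\<tau> \<omega>) k = S k \<omega> + (\<Sum>i<k. h *\<^sub>R (g (\<theta> i \<omega>) - f (\<theta> i \<omega>) (U (?\<tau> \<omega>) i)))" if "k \<le> N" for k \<omega>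
    using that
  proof (induction k)
    case 0
    show ?case using u[of 0] T by (simp add: e_def S_def U_def set_integral_null_singleton)
  next
    case (Suc k)
    have "e (?\<tau> \<omega>) (Suc k) = e (?\<tau> \<omega>) k + ((u (real k * h + h) - u (real k * h)) - h *\<^sub>R f (\<theta> k \<omega>) (U (?\<tau> \<omega>) k))"
      by (simp add: e_def U_def \<theta>_def algebra_simps)
    also have "u (real k * h + h) - u (real k * h) = D (Suc k) \<omega> + h *\<^sub>R g (\<theta> k \<omega>)"
      using u_step[of k] Suc.prems by (simp add: D_def G_def \<theta>_def)
    finally show ?case using Suc by (simp add: S_def scaleR_diff_right)
  qed
  have e_le: "norm (e (?\<tau> \<omega>) k) \<le> norm (S k \<omega>) + (\<Sum>i<k. h * L (\<theta> i \<omega>) * (b i + norm (e (?\<tau> \<omega>) i)))"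
    if k: "k \<le> N" and \<omega>: "\<forall>i. \<theta> i \<omega> \<in> I i" for k \<omega>
  proof -
    have "norm (h *\<^sub>R (g (\<theta> i \<omega>) - f (\<theta> i \<omega>) (U (?\<tau> \<omega>) i))) \<le> h * L (\<theta> i \<omega>) * (b i + norm (e (?\<tau> \<omega>) i))"
      if "i < k" for i
    proof -
      have "norm (u (\<theta> i \<omega>) - U (?\<tau> \<omega>) i) \<le> norm (u (\<theta> i \<omega>) - u (real i * h)) + norm (e (?\<tau> \<omega>) i)"
        using norm_triangle_ineq[of "u (\<theta> i \<omega>) - u (real i * h)" "e (?\<tau> \<omega>) i"] by (simp add: e_def)
      also have "\<dots> \<le> b i + norm (e (?\<tau> \<omega>) i)"
        using that k \<omega> by (intro add_right_mono u_near) auto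
      finally have "L (\<theta> i \<omega>) * norm (u (\<theta> i \<omega>) - U (?\<tau> \<omega>) i) \<le> L (\<theta> i \<omega>) * (b i + norm (e (?\<tau> \<omega>) i))"
        using L_nonneg by (rule mult_left_mono)
      with lip have "norm (g (\<theta> i \<omega>) - f (\<theta> i \<omega>) (U (?\<tau> \<omega>) i)) \<le> L (\<theta> i \<omega>) * (b i + norm (e (?\<tau> \<omega>) i))"
        unfolding g_def by (rule order_trans)
      then show ?thesis using h by (simp add: mult.assoc)
    qed
    then show ?thesis
      unfolding e_eq[OF k] by (intro order_trans[OF norm_triangle_ineq] add_left_mono order_trans[OF norm_sum] sum_mono) auto
  qed
  \<comment> \<open>Only the law of \<open>\<tau>\<close> is prescribed, so the points lie in their
    open steps merely almost surely; countability allows all indices at once.\<close>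
  have \<theta>_AE: "AE \<omega> in M. \<forall>i. \<theta> i \<omega> \<in> I i"
    unfolding AE_all_countable I_def by (intro allI AE_uniform_distr[OF \<theta>_meas \<theta>_distr]) auto
  have E_le: "E n (?\<tau> \<omega>) powr p \<le> 2 powr p * m n \<omega> powr p
      + (\<Sum>i<n. (B * h * L (\<theta> i \<omega>) powr p) * (h powr (p / 2) * Q + E i (?\<tau> \<omega>) powr p))"
    if n: "n \<le> N" and \<omega>: "\<forall>i. \<theta> i \<omega> \<in> I i" for n \<omega>
  proof -
    have "E n (?\<tau> \<omega>) powr p \<le> 2 powr p * m n \<omega> powr p
      + (\<Sum>i<n. 4 powr p * (real n powr (p - 1) * (h * L (\<theta> i \<omega>)) powr p) * (b i powr p + E i (?\<tau> \<omega>) powr p))"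
      unfolding E_def m_def using p h L_nonneg b_nonneg e_le[OF _ \<omega>] n
      by (intro error_recursion_powr) auto
    also have "\<dots> \<le> 2 powr p * m n \<omega> powr p
      + (\<Sum>i<n. (B * h * L (\<theta> i \<omega>) powr p) * (h powr (p / 2) * Q + E i (?\<tau> \<omega>) powr p))"
    proof (intro add_left_mono sum_mono)
      fix i
      \<comment> \<open>From h^p, the part h^(p-1) absorbs n^(p-1) into T^(p-1); the remaining
        \<open>h\<close> turns the mean of L(\<theta>_i)^p into the step integral
        \<open>l i\<close>.\<close>
      have "real n powr (p - 1) * (h * L (\<theta> i \<omega>)) powr p = (real n * h) powr (p - 1) * h * L (\<theta> i \<omega>) powr p"
        using h L_nonneg by (simp add: powr_mult hpow)
      also have "\<dots> \<le> T powr (p - 1) * h * L (\<theta> i \<omega>) powr p"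
        using N n h p order_trans[OF mult_right_mono[of "real n" "real N" h] N]
        by (intro mult_right_mono powr_mono2) auto
      finally have "4 powr p * (real n powr (p - 1) * (h * L (\<theta> i \<omega>)) powr p) \<le> 4 powr p * (T powr (p - 1) * h * L (\<theta> i \<omega>) powr p)"
        by (intro mult_left_mono) auto
      then have W: "4 powr p * (real n powr (p - 1) * (h * L (\<theta> i \<omega>)) powr p) \<le> B * h * L (\<theta> i \<omega>) powr p"
        unfolding B_def by (simp only: mult.assoc)
      show "4 powr p * (real n powr (p - 1) * (h * L (\<theta> i \<omega>)) powr p) * (b i powr p + E i (?\<tau> \<omega>) powr p)
          \<le> (B * h * L (\<theta> i \<omega>) powr p) * (h powr (p / 2) * Q + E i (?\<tau> \<omega>) powr p)"
        by (rule mult_mono[OF W add_right_mono[OF b_le]]) (use B h in auto)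
    qed
    finally show ?thesis .
  qed
  have e_meas: "(\<lambda>d. e d k) \<in> borel_measurable (\<Pi>\<^sub>M j\<in>{1..i}. borel)" if "k \<le> i" for k i
    unfolding e_def U_def using that by (intro borel_measurable_diff measurable_rand_euler f_meas) auto
  have E_meas: "E i \<in> borel_measurable (\<Pi>\<^sub>M j\<in>{1..i}. borel)" for i
    unfolding E_def[abs_def] using e_meas by (intro borel_measurable_Max borel_measurable_norm) auto
  have E_restrict: "E i (restrict (?\<tau> \<omega>) {1..i}) = E i (?\<tau> \<omega>)" for i \<omega>
  proof -
    have "e (restrict (?\<tau> \<omega>) {1..i}) k = e (?\<tau> \<omega>) k" if "k \<le> i" for k
      unfolding e_def U_def using that by (intro arg_cong2[where f = minus] rand_euler_cong) auto
    then show ?thesis unfolding E_def by (intro arg_cong[where f = Max] image_cong) auto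
  qed
  have E_meas' [measurable]: "(\<lambda>\<omega>. E i (?\<tau> \<omega>)) \<in> borel_measurable M" for i
  proof -
    have "(\<lambda>\<omega>. restrict (?\<tau> \<omega>) {1..i}) \<in> measurable M (\<Pi>\<^sub>M j\<in>{1..i}. borel)"
      using \<tau>_meas by (intro measurable_restrict) auto
    from measurable_compose[OF this E_meas] show ?thesis unfolding E_restrict .
  qed
  have L_nn: "(\<integral>\<^sup>+\<omega>. ennreal (B * h * L (\<theta> i \<omega>) powr p) \<partial>M) = ennreal (B * l i)" for i
  proof -
    have "(\<integral>\<^sup>+\<omega>. ennreal (B * h * L (\<theta> i \<omega>) powr p) \<partial>M) = ennreal (expectation (\<lambda>\<omega>. B * h * L (\<theta> i \<omega>) powr p))"
      using B h \<theta>_integrable[OF Lp_int, of i] by (intro nn_integral_eq_integral) auto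
    also have "expectation (\<lambda>\<omega>. B * h * L (\<theta> i \<omega>) powr p) = B * l i"
      using \<theta>_expectation[OF Lp_int, of i] by (simp add: l_def)
    finally show ?thesis .
  qed
  \<comment> \<open>The maximum \<open>E i\<close> uses the entries 1 to i of \<open>\<tau>\<close>,
    while \<theta>_i uses entry i + 1; this shift is what makes the expectation factor.\<close>
  have LE_nn: "(\<integral>\<^sup>+\<omega>. ennreal (B * h * L (\<theta> i \<omega>) powr p) * ennreal (E i (?\<tau> \<omega>) powr p) \<partial>M)
      = ennreal (B * l i) * (\<integral>\<^sup>+\<omega>. ennreal (E i (?\<tau> \<omega>) powr p) \<partial>M)" for i
  proof -
    have F: "(\<lambda>d. ennreal (E i d powr p)) \<in> borel_measurable (\<Pi>\<^sub>M j\<in>{1..i}. borel)"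
      using E_meas[of i] by measurable
    have "indep_var borel (\<lambda>\<omega>. ennreal (E i (?\<tau> \<omega>) powr p)) borel (\<lambda>\<omega>. ennreal (B * h * L (\<theta> i \<omega>) powr p))"
      using indep_var_past_next[OF ind F, of "\<lambda>x. ennreal (B * h * L (real i * h + x * h) powr p)" borel]
      unfolding E_restrict \<theta>_def by simp
    from indep_var_nn_integral[OF this] show ?thesis unfolding L_nn by (simp only: mult.commute)
  qed
  \<comment> \<open>The first summand covers the moment of the sampling errors;
    \<open>B * \<Lambda> * Q\<close> covers the b_i terms, whose weights sum to at most
    \<open>B * \<Lambda>\<close>. Gronwall needs a constant independent of \<open>n\<close>.\<close>
  define a where "a = (2 powr p * (2 powr p * C * exp C) * T powr (p / 2 - 1) * (2 * 2 powr p) + B * \<Lambda>) * Q * h powr (p / 2)"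
  have a: "0 \<le> a" unfolding a_def using B C Q \<Lambda> by (intro mult_nonneg_nonneg add_nonneg_nonneg) auto
  have rec: "(\<integral>\<^sup>+\<omega>. ennreal (E n (?\<tau> \<omega>) powr p) \<partial>M)
      \<le> ennreal a + (\<Sum>i<n. ennreal (B * l i) * (\<integral>\<^sup>+\<omega>. ennreal (E i (?\<tau> \<omega>) powr p) \<partial>M))"
    if n: "n \<le> N" for n
  proof -
    let ?\<beta> = "h powr (p / 2) * Q"
    let ?W = "\<lambda>i \<omega>. B * h * L (\<theta> i \<omega>) powr p"
    have W: "0 \<le> ?W i \<omega>" for i \<omega> using B h by simp
    have "(\<integral>\<^sup>+\<omega>. ennreal (E n (?\<tau> \<omega>) powr p) \<partial>M)
        \<le> (\<integral>\<^sup>+\<omega>. ennreal (2 powr p * m n \<omega> powr p)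
            + (\<Sum>i<n. ennreal (?W i \<omega>) * ennreal ?\<beta> + ennreal (?W i \<omega>) * ennreal (E i (?\<tau> \<omega>) powr p)) \<partial>M)"
    proof (rule nn_integral_mono_AE, rule AE_mp[OF \<theta>_AE], intro AE_I2 impI)
      fix \<omega> assume \<omega>: "\<forall>i. \<theta> i \<omega> \<in> I i"
      have "ennreal (E n (?\<tau> \<omega>) powr p) \<le> ennreal (2 powr p * m n \<omega> powr p
          + (\<Sum>i<n. ?W i \<omega> * (?\<beta> + E i (?\<tau> \<omega>) powr p)))"
        by (intro ennreal_leI E_le n \<omega>)
      also have "\<dots> = ennreal (2 powr p * m n \<omega> powr p) + (\<Sum>i<n. ennreal (?W i \<omega> * (?\<beta> + E i (?\<tau> \<omega>) powr p)))"
        using W Q by (subst ennreal_plus) (auto intro!: sum_nonneg mult_nonneg_nonneg[OF W])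
      also have "(\<Sum>i<n. ennreal (?W i \<omega> * (?\<beta> + E i (?\<tau> \<omega>) powr p)))
          = (\<Sum>i<n. ennreal (?W i \<omega>) * ennreal ?\<beta> + ennreal (?W i \<omega>) * ennreal (E i (?\<tau> \<omega>) powr p))"
        using W Q by (intro sum.cong refl) (simp add: ennreal_mult ennreal_plus distrib_left del: ennreal_plus[symmetric])
      finally show "ennreal (E n (?\<tau> \<omega>) powr p) \<le> ennreal (2 powr p * m n \<omega> powr p)
            + (\<Sum>i<n. ennreal (?W i \<omega>) * ennreal ?\<beta> + ennreal (?W i \<omega>) * ennreal (E i (?\<tau> \<omega>) powr p))" .
    qed
    also have "\<dots> = (\<integral>\<^sup>+\<omega>. ennreal (2 powr p * m n \<omega> powr p) \<partial>M)
        + (\<Sum>i<n. (\<integral>\<^sup>+\<omega>. ennreal (?W i \<omega>) \<partial>M) * ennreal ?\<beta>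
          + (\<integral>\<^sup>+\<omega>. ennreal (?W i \<omega>) * ennreal (E i (?\<tau> \<omega>) powr p) \<partial>M))"
      using borel_measurable_integrable[OF m_int[of n]]
      by (simp add: nn_integral_add nn_integral_sum nn_integral_multc)
    also have "\<dots> = (\<integral>\<^sup>+\<omega>. ennreal (2 powr p * m n \<omega> powr p) \<partial>M) + (\<Sum>i<n. ennreal (B * l i) * ennreal ?\<beta>)
        + (\<Sum>i<n. ennreal (B * l i) * (\<integral>\<^sup>+\<omega>. ennreal (E i (?\<tau> \<omega>) powr p) \<partial>M))"
      unfolding L_nn LE_nn by (simp only: sum.distrib add.assoc)
    also have "\<dots> \<le> ennreal a + (\<Sum>i<n. ennreal (B * l i) * (\<integral>\<^sup>+\<omega>. ennreal (E i (?\<tau> \<omega>) powr p) \<partial>M))"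
    proof (rule add_right_mono)
      have "(\<integral>\<^sup>+\<omega>. ennreal (2 powr p * m n \<omega> powr p) \<partial>M) = ennreal (2 powr p * expectation (\<lambda>\<omega>. m n \<omega> powr p))"
        using m_int[of n] by (subst nn_integral_eq_integral) auto
      moreover have "(\<Sum>i<n. ennreal (B * l i) * ennreal ?\<beta>) = ennreal (B * (\<Sum>i<n. l i) * ?\<beta>)"
        using B Q l_nonneg by (simp add: ennreal_mult[symmetric] sum_distrib_left sum_distrib_right)
      moreover have "2 powr p * expectation (\<lambda>\<omega>. m n \<omega> powr p) + B * (\<Sum>i<n. l i) * ?\<beta> \<le> a"
      proof -
        have "2 powr p * expectation (\<lambda>\<omega>. m n \<omega> powr p)
            \<le> 2 powr p * (2 powr p * C * exp C * T powr (p / 2 - 1) * (2 * 2 powr p) * h powr (p / 2) * Q)"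
          by (intro mult_left_mono m_moment n) auto
        moreover have "B * (\<Sum>i<n. l i) * ?\<beta> \<le> B * \<Lambda> * ?\<beta>"
          using B Q by (intro mult_right_mono mult_left_mono l_sum) auto
        ultimately have "2 powr p * expectation (\<lambda>\<omega>. m n \<omega> powr p) + B * (\<Sum>i<n. l i) * ?\<beta>
            \<le> 2 powr p * (2 powr p * C * exp C * T powr (p / 2 - 1) * (2 * 2 powr p) * h powr (p / 2) * Q) + B * \<Lambda> * ?\<beta>"
          by (rule add_mono)
        also have "\<dots> = a" unfolding a_def by algebra
        finally show ?thesis .
      qed
      ultimately show "(\<integral>\<^sup>+\<omega>. ennreal (2 powr p * m n \<omega> powr p) \<partial>M) + (\<Sum>i<n. ennreal (B * l i) * ennreal ?\<beta>) \<le> ennreal a"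
        using B Q l_nonneg
        by (simp add: ennreal_plus[symmetric] ennreal_leI sum_nonneg Bochner_Integration.integral_nonneg del: ennreal_plus)
    qed
    finally show ?thesis .
  qed
  have "(\<integral>\<^sup>+\<omega>. ennreal (E N (?\<tau> \<omega>) powr p) \<partial>M) \<le> ennreal (a * exp (\<Sum>i<N. B * l i))"
    using B l_nonneg by (intro discrete_gronwall_ennreal[OF a _ rec]) auto
  also have "\<dots> \<le> ennreal (a * exp (B * \<Lambda>))"
    using a B l_sum[of N] by (intro ennreal_leI mult_left_mono) (auto simp: sum_distrib_left[symmetric] mult_left_mono)
  also have "a * exp (B * \<Lambda>) = (2 powr p * (2 powr p * C * exp C) * T powr (p / 2 - 1) * (2 * 2 powr p) + B * \<Lambda>) * Q
        * exp (B * \<Lambda>) * h powr (p / 2)"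
    by (simp add: a_def)
  finally show ?thesis by (simp add: E_def e_def U_def)
qed

section \<open>Reduction to the Borel case\<close>

lemma Lp_norm_finite_iff: "Lp_norm M p X < \<infinity> \<longleftrightarrow> (\<integral>\<^sup>+\<omega>. ennreal (\<bar>X \<omega>\<bar> powr p) \<partial>M) < \<infinity>"
  by (simp add: Lp_norm_def Let_def less_top[symmetric])

lemma Lp_norm_le:
  assumes "(\<integral>\<^sup>+\<omega>. ennreal (\<bar>X \<omega>\<bar> powr p) \<partial>M) \<le> ennreal c" and "0 \<le> c" "0 < p"
  shows "Lp_norm M p X \<le> ennreal (c powr (1 / p))"
proof -
  define I where "I = (\<integral>\<^sup>+\<omega>. ennreal (\<bar>X \<omega>\<bar> powr p) \<partial>M)"
  have "I \<noteq> \<infinity>" using assms(1) by (auto simp: I_def[symmetric] top_unique)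
  moreover have "enn2real I \<le> c" using assms by (simp add: I_def[symmetric] enn2real_leI)
  ultimately show ?thesis
    using assms by (auto simp: Lp_norm_def Let_def I_def[symmetric] intro!: ennreal_leI powr_mono2)
qed

lemma measurable_truncate:
  fixes \<phi> :: "real \<Rightarrow> real"
  assumes "\<phi> \<in> borel_measurable (restrict_space borel S)" "S \<in> sets borel" "A \<in> sets borel" "A \<subseteq> S"
  shows "(\<lambda>t. indicator A t * \<phi> t) \<in> borel_measurable borel"
proof -
  have S_meas: "(\<lambda>t. indicator S t *\<^sub>R \<phi> t) \<in> borel_measurable borel"
    using assms by (subst (asm) borel_measurable_restrict_space_iff) auto
  have eq: "(\<lambda>t. indicator A t * \<phi> t) = (\<lambda>t. indicator A t * (indicator S t *\<^sub>R \<phi> t))"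
    using assms(4) by (auto simp: indicator_def fun_eq_iff)
  show ?thesis
    unfolding eq using assms(3) by (intro borel_measurable_times borel_measurable_indicator S_meas) auto
qed

lemma integrable_truncate_powr:
  fixes \<phi> :: "real \<Rightarrow> real"
  assumes \<phi>: "\<phi> \<in> borel_measurable (restrict_space borel S)" and S: "S \<in> sets borel" and A: "A \<in> sets borel" "A \<subseteq> S"
    and fin: "Lp_norm (restrict_space lborel S) p \<phi> < \<infinity>" and nonneg: "\<And>t. t \<in> S \<Longrightarrow> 0 \<le> \<phi> t"
  shows "integrable lborel (\<lambda>t. (indicator A t * \<phi> t) powr p)"
proof (rule integrableI_bounded)
  show "(\<lambda>t. (indicator A t * \<phi> t) powr p) \<in> borel_measurable lborel"
    using measurable_truncate[OF \<phi> S A] by measurable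
  have "(\<integral>\<^sup>+t. ennreal (norm ((indicator A t * \<phi> t) powr p)) \<partial>lborel)
      \<le> (\<integral>\<^sup>+t. ennreal (\<bar>\<phi> t\<bar> powr p) * indicator S t \<partial>lborel)"
    using A(2) nonneg by (intro nn_integral_mono) (auto simp: indicator_def)
  also have "\<dots> < \<infinity>"
    using fin S unfolding Lp_norm_finite_iff by (subst (asm) nn_integral_restrict_space) auto
  finally show "(\<integral>\<^sup>+t. ennreal (norm ((indicator A t * \<phi> t) powr p)) \<partial>lborel) < \<infinity>" .
qed

lemma num_steps_le: "0 < h \<Longrightarrow> 0 \<le> T \<Longrightarrow> real (num_steps T h) * h \<le> T"
  using num_steps_eq_iff[of h T "num_steps T h"] by simp

theorem theorem4p3:
  fixes T p :: real
    and u\<^sub>0 :: "real ^ 'd"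
    and f :: "real \<Rightarrow> real ^ 'd \<Rightarrow> real ^ 'd"
    and L K :: "real \<Rightarrow> real"
    and u :: "real \<Rightarrow> real ^ 'd"
    and M :: "'w measure"
    and \<tau> :: "nat \<Rightarrow> 'w \<Rightarrow> real"
  assumes "0 < T" and "2 \<le> p"
    and "prob_space M"
    and "prob_space.indep_vars M (\<lambda>_. borel) \<tau> {1..}"
    and "\<And>j. 1 \<le> j \<Longrightarrow> distr M borel (\<tau> j) = uniform_measure lborel {0<..<1}"
    and "(\<lambda>(t, x). f t x) \<in> borel_measurable (restrict_space borel {0..T} \<Otimes>\<^sub>M borel)"
    and "L \<in> borel_measurable (restrict_space borel {0..T})"
    and "K \<in> borel_measurable (restrict_space borel {0..T})"
    and "\<And>t. t \<in> {0..T} \<Longrightarrow> 0 \<le> L t"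
    and "\<And>t. t \<in> {0..T} \<Longrightarrow> 0 \<le> K t"
    and "Lp_norm (restrict_space lborel {0..T}) p L < \<infinity>"
    and "Lp_norm (restrict_space lborel {0..T}) p K < \<infinity>"
    and "AE t\<in>{0..T} in lborel. \<forall>x1 x2. norm (f t x1 - f t x2) \<le> L t * norm (x1 - x2)"
    and "AE t\<in>{0..T} in lborel. norm (f t 0) \<le> K t"
    and "is_ode_solution T f u\<^sub>0 u"
  shows "\<exists>C>0. \<forall>h\<in>{0<..<1}.
    Lp_norm M p
      (\<lambda>\<omega>. Max ((\<lambda>n. norm (u (real n * h) - rand_euler f u\<^sub>0 h (\<lambda>j. \<tau> j \<omega>) n)) ` {0..num_steps T h}))
    \<le> ennreal (C * h powr (1 / 2))"
proof -
  interpret prob_space M by fact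
  note T = assms(1) and p = assms(2) and ind = assms(4) and unif = assms(5) and f_meas = assms(6)
    and L_nonneg = assms(9) and K_nonneg = assms(10)
  have g_set_int: "set_integrable lborel {0..T} (\<lambda>s. f s (u s))"
    and u: "\<And>t. t \<in> {0..T} \<Longrightarrow> u t = u\<^sub>0 + (LINT s:{0..t}|lborel. f s (u s))"
    using assms(15) by (auto simp: is_ode_solution_def)

  define P where "P t \<longleftrightarrow> (\<forall>x1 x2. norm (f t x1 - f t x2) \<le> L t * norm (x1 - x2)) \<and> norm (f t 0) \<le> K t" for t
  have "AE t in lborel. t \<in> {0..T} \<longrightarrow> P t"
    using assms(13,14) by eventually_elim (auto simp: P_def)
  \<comment> \<open>The exceptional set itself need not be measurable; a measurable null superset
    keeps \<open>A\<close> Borel.\<close>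
  then obtain N where N: "{t. \<not> (t \<in> {0..T} \<longrightarrow> P t)} \<subseteq> N" "N \<in> sets lborel" "emeasure lborel N = 0"
    by (auto elim!: AE_E)
  define A where "A = {0..T} - N"
  have A [measurable]: "A \<in> sets borel" and A_sub: "A \<subseteq> {0..T}" and A_P: "\<And>t. t \<in> A \<Longrightarrow> P t"
    using N by (auto simp: A_def)
  have A_AE: "AE t in lborel. t \<in> {0..T} \<longrightarrow> t \<in> A"
  proof (rule AE_I'[of N])
    show "N \<in> null_sets lborel" using N by auto
  qed (auto simp: A_def)

  \<comment> \<open>The null set depends on time only. Switching \<open>f\<close> off outside
    \<open>A\<close> makes the bounds hold for every time and state and leaves the integral equation
    for \<open>u\<close> intact.\<close>
  define f' where "f' t x = indicator A t *\<^sub>R f t x" for t x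
  define L' where "L' t = indicator A t * L t" for t
  define K' where "K' t = indicator A t * K t" for t
  have f'_meas: "(\<lambda>(t, x). f' t x) \<in> borel_measurable (borel \<Otimes>\<^sub>M borel)"
  proof -
    \<comment> \<open>Composing with the identity on the strip and extending by zero passes from the
      restricted sigma-algebra to Borel measurability on the whole space.\<close>
    have "(\<lambda>z. (fst z, snd z)) \<in> measurable (restrict_space (borel \<Otimes>\<^sub>M borel) ({0..T} \<times> UNIV))
        (restrict_space borel {0..T} \<Otimes>\<^sub>M borel)"
      by (intro measurable_Pair measurable_restrict_space3 measurable_restrict_space1) auto
    from measurable_compose[OF this f_meas]
    have [measurable]: "(\<lambda>z. indicator ({0..T} \<times> UNIV) z *\<^sub>R f (fst z) (snd z)) \<in> borel_measurable (borel \<Otimes>\<^sub>M borel)"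
      by (subst (asm) borel_measurable_restrict_space_iff) (auto simp: case_prod_unfold)
    have "(\<lambda>(t, x). f' t x) = (\<lambda>z. indicator A (fst z) *\<^sub>R (indicator ({0..T} \<times> UNIV) z *\<^sub>R f (fst z) (snd z)))"
      using A_sub by (auto simp: f'_def fun_eq_iff indicator_def)
    then show ?thesis by (simp only:) measurable
  qed
  have L'_meas: "L' \<in> borel_measurable borel"
    unfolding L'_def[abs_def] using assms(7) A A_sub by (intro measurable_truncate[of _ "{0..T}"]) auto
  have L'_nonneg: "0 \<le> L' t" for t using L_nonneg A_sub by (auto simp: L'_def indicator_def)
  have K'_nonneg: "0 \<le> K' t" for t using K_nonneg A_sub by (auto simp: K'_def indicator_def)
  have lip: "norm (f' t x - f' t y) \<le> L' t * norm (x - y)" for t x y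
    using A_P[of t] by (auto simp: f'_def L'_def P_def indicator_def)
  have f'_0: "norm (f' t 0) \<le> K' t" for t
    using A_P[of t] by (auto simp: f'_def K'_def P_def indicator_def)
  have L'p_int: "integrable lborel (\<lambda>t. L' t powr p)"
    unfolding L'_def using assms(7,11) A A_sub L_nonneg by (intro integrable_truncate_powr[of _ "{0..T}"]) auto
  have K'p_int: "integrable lborel (\<lambda>t. K' t powr p)"
    unfolding K'_def using assms(8,12) A A_sub K_nonneg by (intro integrable_truncate_powr[of _ "{0..T}"]) auto

  have g_eq: "f' s (u s) = indicator A s *\<^sub>R (indicator {0..T} s *\<^sub>R f s (u s))" for s
    using A_sub by (auto simp: f'_def indicator_def)
  have g_int: "integrable lborel (\<lambda>s. f' s (u s))"
    unfolding g_eq by (rule integrable_mult_indicator[OF _ g_set_int[unfolded set_integrable_def]]) simp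
  have u': "u t = u\<^sub>0 + (LINT s:{0..t}|lborel. f' s (u s))" if t: "t \<in> {0..T}" for t
  proof -
    have "set_integrable lborel {0..t} (\<lambda>s. f s (u s))"
      by (rule set_integrable_subset[OF g_set_int]) (use t in auto)
    then have "(LINT s:{0..t}|lborel. f' s (u s)) = (LINT s:{0..t}|lborel. f s (u s))"
      unfolding set_lebesgue_integral_def set_integrable_def
    proof (intro integral_cong_AE)
      show "AE s in lborel. indicator {0..t} s *\<^sub>R f' s (u s) = indicator {0..t} s *\<^sub>R f s (u s)"
        using A_AE by eventually_elim (use t in \<open>auto simp: f'_def indicator_def\<close>)
      show "(\<lambda>s. indicator {0..t} s *\<^sub>R f' s (u s)) \<in> borel_measurable lborel"
        using borel_measurable_integrable[OF g_int] by measurable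
    qed auto
    then show ?thesis using u[OF t] by simp
  qed
  \<comment> \<open>The notion of solution only makes the derivative integrable. Boundedness of
    \<open>u\<close> by \<open>R\<close> and the growth bound K' + R L' raise this to
    p-integrability, on which the rate rests.\<close>
  define R where "R = norm u\<^sub>0 + (LINT s|lborel. norm (f' s (u s)))"
  have R: "0 \<le> R" unfolding R_def by (intro add_nonneg_nonneg Bochner_Integration.integral_nonneg) auto
  have u_le: "norm (u t) \<le> R" if "t \<in> {0..T}" for t
  proof -
    have "norm (u t) \<le> norm u\<^sub>0 + norm (LINT s:{0..t}|lborel. f' s (u s))"
      using u'[OF that] by (metis norm_triangle_ineq)
    also have "norm (LINT s:{0..t}|lborel. f' s (u s)) \<le> (LINT s:UNIV|lborel. norm (f' s (u s)))"
      by (intro norm_set_integral_le_superset g_int) auto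
    finally show ?thesis by (simp add: R_def set_lebesgue_integral_def)
  qed
  have g_le: "norm (f' t (u t)) powr p \<le> 2 powr p * (K' t powr p + R powr p * L' t powr p)" for t
  proof (cases "t \<in> A")
    case True
    have "norm (f' t (u t)) \<le> norm (f' t 0) + norm (f' t (u t) - f' t 0)" by (rule norm_triangle_sub)
    also have "\<dots> \<le> K' t + L' t * norm (u t - 0)" by (intro add_mono f'_0 lip)
    also have "\<dots> \<le> K' t + L' t * R"
      using u_le True A_sub L'_nonneg by (intro add_left_mono mult_left_mono) auto
    finally have "norm (f' t (u t)) powr p \<le> (K' t + L' t * R) powr p"
      using p by (intro powr_mono2) auto
    also have "\<dots> \<le> 2 powr p * (K' t powr p + (L' t * R) powr p)"
      using p R K'_nonneg L'_nonneg by (intro powr_add_le) auto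
    also have "(L' t * R) powr p = R powr p * L' t powr p"
      by (simp add: powr_mult)
    finally show ?thesis .
  qed (simp add: f'_def)
  have gp_int: "integrable lborel (\<lambda>s. norm (f' s (u s)) powr p)"
  proof (rule Bochner_Integration.integrable_bound)
    show "integrable lborel (\<lambda>t. 2 powr p * (K' t powr p + R powr p * L' t powr p))"
      by (intro integrable_mult_right Bochner_Integration.integrable_add K'p_int L'p_int)
    show "AE s in lborel. norm (norm (f' s (u s)) powr p) \<le> norm (2 powr p * (K' s powr p + R powr p * L' s powr p))"
      unfolding real_norm_def by (intro AE_I2 order_trans[OF _ abs_ge_self]) (simp only: abs_of_nonneg powr_ge_zero g_le)
    show "(\<lambda>s. norm (f' s (u s)) powr p) \<in> borel_measurable lborel"
      using borel_measurable_integrable[OF g_int] by measurable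
  qed

  obtain c where c: "\<And>h n. 0 < h \<Longrightarrow> h < 1 \<Longrightarrow> real n * h \<le> T \<Longrightarrow>
      (\<integral>\<^sup>+\<omega>. ennreal (Max ((\<lambda>n. norm (u (real n * h) - rand_euler f' u\<^sub>0 h (\<lambda>j. \<tau> j \<omega>) n)) ` {0..n}) powr p) \<partial>M)
      \<le> ennreal (c * h powr (p / 2))"
    using rand_euler_error_borel[OF p T ind unif f'_meas L'_meas L'_nonneg lip g_int gp_int L'p_int u'] by blast
  \<comment> \<open>The maximum with 1 ensures positivity, as nothing is known about the sign of
    \<open>c\<close>.\<close>
  define C where "C = max 1 c powr (1 / p)"
  show ?thesis
  proof (intro exI[of _ C] conjI ballI)
    show "0 < C" by (simp add: C_def)
    fix h :: real assume "h \<in> {0<..<1}"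
    then have h: "0 < h" "h < 1" by auto
    define n where "n = num_steps T h"
    have n: "real n * h \<le> T" unfolding n_def using h T by (intro num_steps_le) auto
    have \<tau>_meas [measurable]: "\<tau> (Suc i) \<in> borel_measurable M" for i
      using ind by (auto simp: indep_vars_def)
    \<comment> \<open>Only indices below \<open>n\<close> qualify: their steps lie inside [0,T],
      where \<open>A\<close> has full measure, whereas \<open>f'\<close> vanishes beyond
      \<open>T\<close>.\<close>
    have "AE \<omega> in M. i < n \<longrightarrow> real i * h + \<tau> (Suc i) \<omega> * h \<in> A" for i
    proof (cases "i < n")
      case True
      then have "(real i + 1) * h \<le> real n * h" using h by (intro mult_right_mono) auto
      then have "real i * h + h \<le> T" using n by (simp add: algebra_simps)
      moreover have "0 \<le> real i * h" using h by simp
      ultimately have sub: "t \<in> {0..T}" if "t \<in> {real i * h<..<real i * h + h}" for t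
        using that unfolding atLeastAtMost_iff greaterThanLessThan_iff by linarith
      have "AE t in lborel. t \<in> {real i * h<..<real i * h + h} \<longrightarrow> t \<in> A"
        using A_AE by eventually_elim (use sub in blast)
      moreover have "distr M borel (\<lambda>\<omega>. real i * h + \<tau> (Suc i) \<omega> * h) = uniform_measure lborel {real i * h<..<real i * h + h}"
        using h by (intro distr_uniform_affine unif) auto
      ultimately have "AE \<omega> in M. real i * h + \<tau> (Suc i) \<omega> * h \<in> A"
        by (intro AE_uniform_distr) auto
      then show ?thesis by simp
    qed simp
    then have "AE \<omega> in M. \<forall>i. i < n \<longrightarrow> real i * h + \<tau> (Suc i) \<omega> * h \<in> A"
      unfolding AE_all_countable by (rule allI)
    then have eq: "AE \<omega> in M. \<forall>k\<in>{0..n}. rand_euler f u\<^sub>0 h (\<lambda>j. \<tau> j \<omega>) k = rand_euler f' u\<^sub>0 h (\<lambda>j. \<tau> j \<omega>) k"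
    proof eventually_elim
      case (elim \<omega>)
      have "rand_euler f u\<^sub>0 h (\<lambda>j. \<tau> j \<omega>) k = rand_euler f' u\<^sub>0 h (\<lambda>j. \<tau> j \<omega>) k" if "k \<le> n" for k
        using that elim by (induction k) (auto simp: f'_def)
      then show ?case by auto
    qed
    have "(\<integral>\<^sup>+\<omega>. ennreal (\<bar>Max ((\<lambda>n. norm (u (real n * h) - rand_euler f u\<^sub>0 h (\<lambda>j. \<tau> j \<omega>) n)) ` {0..n})\<bar> powr p) \<partial>M)
      = (\<integral>\<^sup>+\<omega>. ennreal (Max ((\<lambda>n. norm (u (real n * h) - rand_euler f' u\<^sub>0 h (\<lambda>j. \<tau> j \<omega>) n)) ` {0..n}) powr p) \<partial>M)"
    proof (intro nn_integral_cong_AE)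
      show "AE \<omega> in M. ennreal (\<bar>Max ((\<lambda>n. norm (u (real n * h) - rand_euler f u\<^sub>0 h (\<lambda>j. \<tau> j \<omega>) n)) ` {0..n})\<bar> powr p)
        = ennreal (Max ((\<lambda>n. norm (u (real n * h) - rand_euler f' u\<^sub>0 h (\<lambda>j. \<tau> j \<omega>) n)) ` {0..n}) powr p)"
        using eq
      proof eventually_elim
        case (elim \<omega>)
        have "(\<lambda>n. norm (u (real n * h) - rand_euler f u\<^sub>0 h (\<lambda>j. \<tau> j \<omega>) n)) ` {0..n}
            = (\<lambda>n. norm (u (real n * h) - rand_euler f' u\<^sub>0 h (\<lambda>j. \<tau> j \<omega>) n)) ` {0..n}"
          using elim by (intro image_cong) auto
        then show ?case
          using Max_norm_nonneg[of "\<lambda>n. u (real n * h) - rand_euler f' u\<^sub>0 h (\<lambda>j. \<tau> j \<omega>) n" n] by simp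
      qed
    qed
    also have "\<dots> \<le> ennreal (c * h powr (p / 2))" using h n by (rule c)
    also have "\<dots> \<le> ennreal (max 1 c * h powr (p / 2))" by (intro ennreal_leI mult_right_mono) auto
    finally have "Lp_norm M p (\<lambda>\<omega>. Max ((\<lambda>n. norm (u (real n * h) - rand_euler f u\<^sub>0 h (\<lambda>j. \<tau> j \<omega>) n)) ` {0..n}))
        \<le> ennreal ((max 1 c * h powr (p / 2)) powr (1 / p))"
      using p by (intro Lp_norm_le) auto
    also have "(max 1 c * h powr (p / 2)) powr (1 / p) = C * h powr (1 / 2)"
      using p by (simp add: C_def powr_mult powr_powr)
    finally show "Lp_norm M p (\<lambda>\<omega>. Max ((\<lambda>n. norm (u (real n * h) - rand_euler f u\<^sub>0 h (\<lambda>j. \<tau> j \<omega>) n)) ` {0..num_steps T h}))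
        \<le> ennreal (C * h powr (1 / 2))" unfolding n_def .
  qed
qed

end
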